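(* Let $\kappa>0$, $q:=e^{-2\kappa}$ and $\gamma_n:=\tanh(\kappa n)$ for $n\in\mathbb{N}$. Consider the infinite system of ordinary differential equations \[ \dot q_n(t)=-q_n(t)+\frac{\gamma_n}{2}\bigl(q_{n-1}(t)+q_{n+1}(t)\bigr),\qquad n\in\mathbb{N}, \] with the boundary condition $q_0(t):=0$. Let $q_{n,0}\in[-1,1]$, $n\in\mathbb{N}$. The unique solution $(q_n(t))_{n\in\mathbb{N}}$ of this system satisfying $q_n(0)=q_{n,0}$ for all $n\in\mathbb{N}$ is given by \[ q_n(t)=\sum_{k=1}^{\infty}q_n^{(k)}(t)\,q_{k,0}, \] where $(q_n^{(k)}(t))_{n\in\mathbb{N}}$ denotes the solution of the system satisfying $q_n^{(k)}(0)=\delta_{k,n}$. Furthermore, \[ q_n^{(k)}(t)=\frac{2}{\pi\gamma_1}\sqrt{\frac{\gamma_n}{\gamma_k}}\int_0^{\pi}e^{-t(1-\cos\theta)}\sin^2(\theta)\,P_n(\theta)P_k(\theta)\left|\frac{(q,qe^{2{\rm i}\theta};q)_\infty}{(-q,-qe^{2{\rm i}\theta};q)_\infty}\right|^2{\rm d}\theta, \] and \[ q_n^{(k)}(t)=\frac{1}{\gamma_1}\sqrt{\frac{2}{\pi}\frac{\gamma_n}{\gamma_k}}\,\frac{(q;q)_\infty^4}{(-q;q)_\infty^4}\,\frac{P_n(0)P_k(0)}{t^{3/2}}+O\!\left(t^{-5/2}\right),\qquad t\to+\infty. \]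
   Context: For $a\in\mathbb{C}$ and $n\in\mathbb{N}_0\cup\{\infty\}$, $(a;q)_n:=\prod_{j=0}^{n-1}(1-aq^j)$, and $(a_1,\dots,a_r;q)_n:=(a_1;q)_n\cdots(a_r;q)_n$. Here $\mathbb{N}=\{1,2,\dots\}$. For $n\in\mathbb{N}$ and $\theta\in\mathbb{R}$, \[ P_n(\theta):=\sqrt{\frac{\gamma_1}{\gamma_n}}\sum_{k=0}^{n-1}\frac{(-q;q)_k(-q;q)_{n-1-k}}{(q;q)_k(q;q)_{n-1-k}}\cos\bigl((2k-n+1)\theta\bigr). \] (The system describes the magnetizations $q_n(t)$ of a semi-infinite kinetic Ising chain with Glauber dynamics and hyperbolically decaying temperature.)
   Formalization: Uniqueness is asserted for t ≥ 0 among solutions bounded uniformly in n on each interval [0,T]; without such a condition it fails (take zero data, q_1(t)=e^{-1/t²}, and solve recursively for q_{n+1}). *)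

theory Defs
  imports "HOL-Analysis.Analysis" "HOL-Library.Landau_Symbols"
begin

definition qpoch :: "'a::real_normed_field \<Rightarrow> 'a \<Rightarrow> nat \<Rightarrow> 'a" where
  "qpoch a q n = (\<Prod>j<n. 1 - a * q ^ j)"

definition qpoch_inf :: "'a::real_normed_field \<Rightarrow> 'a \<Rightarrow> 'a" where
  "qpoch_inf a q = (\<Prod>j. 1 - a * q ^ j)"

definition qpar :: "real \<Rightarrow> real" where
  "qpar \<kappa> = exp (- 2 * \<kappa>)"

definition gam :: "real \<Rightarrow> nat \<Rightarrow> real" where
  "gam \<kappa> n = tanh (\<kappa> * real n)"

definition Ppol :: "real \<Rightarrow> nat \<Rightarrow> real \<Rightarrow> real" where
  "Ppol \<kappa> n \<theta> = sqrt (gam \<kappa> 1 / gam \<kappa> n) *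
     (\<Sum>k<n. (qpoch (- qpar \<kappa>) (qpar \<kappa>) k * qpoch (- qpar \<kappa>) (qpar \<kappa>) (n - 1 - k)) /
              (qpoch (qpar \<kappa>) (qpar \<kappa>) k * qpoch (qpar \<kappa>) (qpar \<kappa>) (n - 1 - k))
            * cos ((2 * real k - real n + 1) * \<theta>))"

definition glauber_sol :: "real \<Rightarrow> (nat \<Rightarrow> real \<Rightarrow> real) \<Rightarrow> bool" where
  "glauber_sol \<kappa> x \<longleftrightarrow>
     (\<forall>t\<ge>0. x 0 t = 0) \<and>
     (\<forall>n\<ge>1. \<forall>t\<ge>0. ((x n) has_real_derivative
          (- x n t + gam \<kappa> n / 2 * (x (n - 1) t + x (n + 1) t))) (at t within {0..})) \<and>
     (\<forall>T\<ge>0. \<exists>B. \<forall>n. \<forall>t\<in>{0..T}. \<bar>x n t\<bar> \<le> B)"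

definition qk :: "real \<Rightarrow> nat \<Rightarrow> nat \<Rightarrow> real \<Rightarrow> real" where
  "qk \<kappa> k n t = 2 / (pi * gam \<kappa> 1) * sqrt (gam \<kappa> n / gam \<kappa> k) *
     integral {0..pi} (\<lambda>\<theta>. exp (- t * (1 - cos \<theta>)) * (sin \<theta>)\<^sup>2 * Ppol \<kappa> n \<theta> * Ppol \<kappa> k \<theta> *
        (cmod ((qpoch_inf (complex_of_real (qpar \<kappa>)) (complex_of_real (qpar \<kappa>)) *
                qpoch_inf (complex_of_real (qpar \<kappa>) * exp (2 * \<i> * complex_of_real \<theta>)) (complex_of_real (qpar \<kappa>))) /
               (qpoch_inf (- complex_of_real (qpar \<kappa>)) (complex_of_real (qpar \<kappa>)) *
                qpoch_inf (- complex_of_real (qpar \<kappa>) * exp (2 * \<i> * complex_of_real \<theta>)) (complex_of_real (qpar \<kappa>)))))\<^sup>2)"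

end

theory Submission
  imports Defs "HOL-Complex_Analysis.Cauchy_Integral_Formula" "HOL-Probability.Distributions"
begin

text \<open>
  The right-hand side of the system is a bounded operator on bounded sequences, so solutions are
  exponential series in the iterates of \<open>x \<mapsto> (\<gamma>\<^sub>n (x\<^sub>n\<^sub>-\<^sub>1 + x\<^sub>n\<^sub>+\<^sub>1) / 2)\<close>, and uniqueness is
  Gronwall's argument. With \<open>D\<^sub>n = P\<^sub>n \<surd>(\<gamma>\<^sub>n / \<gamma>\<^sub>1)\<close> (continuous \<open>q\<close>-ultraspherical polynomials with
  \<open>\<beta> = -q\<close>) one has \<open>cos \<theta> D\<^sub>n = \<gamma>\<^sub>n (D\<^sub>n\<^sub>-\<^sub>1 + D\<^sub>n\<^sub>+\<^sub>1) / 2\<close>, so the integral formula amounts to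
  the orthogonality of the \<open>D\<^sub>n\<close> with respect to the stated weight.

  For the orthogonality, the recurrence with \<open>2 cos \<theta> = z + 1/z\<close> has a solution
  \<open>m\<^sub>n(z) = z\<^sup>n \<Sum>\<^sub>j (R\<^sub>j - R\<^sub>j\<^sub>-\<^sub>1) q\<^sup>n\<^sup>j\<close> which is analytic in the disc and equals 1 at \<open>n = 0\<close>; here
  \<open>R\<^sub>j = \<Prod>\<^sub>i\<^sub>>\<^sub>j (1 - q\<^sup>i)(1 - q\<^sup>i z\<^sup>2) / ((1 + q\<^sup>i)(1 + q\<^sup>i z\<^sup>2))\<close>. Constancy of the Wronskian of \<open>m\<close> and
  its conjugate gives \<open>Im m\<^sub>n = D\<^sub>n sin \<theta> |R\<^sub>0|\<^sup>2\<close> on the unit circle, where \<open>|R\<^sub>0|\<^sup>2\<close> is the weight, and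
  Cauchy's formula evaluates the integral of \<open>sin \<theta> Im m\<^sub>n\<close>. The asymptotics is Laplace's method
  in the variable \<open>sin (\<theta> / 2)\<close>.
\<close>

section \<open>The flow on bounded sequences\<close>

lemma gam_0 [simp]: "gam \<kappa> 0 = 0"
  by (simp add: gam_def)

lemma gam_bounds:
  assumes "\<kappa> > 0"
  shows "0 \<le> gam \<kappa> n" "gam \<kappa> n \<le> 1"
proof -
  show "0 \<le> gam \<kappa> n"
    using assms by (simp add: gam_def)
  show "gam \<kappa> n \<le> 1"
    using tanh_real_lt_1[of "\<kappa> * real n"] by (simp add: gam_def)
qed

text \<open>Iterates of the coupling operator alone; the damping is left to
  \<open>glauber_flow\<close>. Site 0 starts at 0 and stays there because
  \<open>gam \<kappa> 0 = 0\<close>, which also neutralises the truncated \<open>n - 1\<close> at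
  \<open>n = 0\<close>.\<close>

primrec glauber_iter :: "real \<Rightarrow> (nat \<Rightarrow> real) \<Rightarrow> nat \<Rightarrow> nat \<Rightarrow> real" where
  "glauber_iter \<kappa> a 0 n = (if n = 0 then 0 else a n)"
| "glauber_iter \<kappa> a (Suc j) n =
     gam \<kappa> n / 2 * (glauber_iter \<kappa> a j (n - 1) + glauber_iter \<kappa> a j (n + 1))"

text \<open>The factor \<open>exp (- t)\<close> integrates out the damping, so the remaining series
  is the exponential of t times the coupling operator, applied to \<open>a\<close>.\<close>

definition glauber_flow :: "real \<Rightarrow> (nat \<Rightarrow> real) \<Rightarrow> nat \<Rightarrow> real \<Rightarrow> real" where
  "glauber_flow \<kappa> a n t = exp (- t) * (\<Sum>j. glauber_iter \<kappa> a j n / fact j * t ^ j)"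

lemma glauber_iter_0_right [simp]: "glauber_iter \<kappa> a j 0 = 0"
  by (cases j) auto

text \<open>Each step multiplies the average of two neighbours by a number in [0, 1], so the
  supremum norm cannot grow.\<close>

lemma glauber_iter_bound:
  assumes "\<kappa> > 0" "\<And>n. n \<ge> 1 \<Longrightarrow> \<bar>a n\<bar> \<le> 1"
  shows "\<bar>glauber_iter \<kappa> a j n\<bar> \<le> 1"
proof (induction j arbitrary: n)
  case 0
  then show ?case using assms by auto
next
  case (Suc j)
  let ?s = "glauber_iter \<kappa> a j (n - 1) + glauber_iter \<kappa> a j (n + 1)"
  have s: "\<bar>?s\<bar> \<le> 2"
    using Suc[of "n - 1"] Suc[of "n + 1"] by linarith
  have "\<bar>glauber_iter \<kappa> a (Suc j) n\<bar> = gam \<kappa> n / 2 * \<bar>?s\<bar>"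
    using gam_bounds[OF assms(1)] by (simp add: abs_mult)
  also have "\<dots> \<le> 1 / 2 * 2"
    by (intro mult_mono) (use s gam_bounds[OF assms(1)] in auto)
  finally show ?case by simp
qed

text \<open>Finite speed of propagation: one iteration moves information by one site, so data
  vanishing up to \<open>K\<close> need more than \<open>K - n\<close> iterations to be felt at site
  \<open>n\<close>.\<close>

lemma glauber_iter_eq_0:
  assumes "\<And>n. n \<le> K \<Longrightarrow> a n = 0" "n + j \<le> K"
  shows "glauber_iter \<kappa> a j n = 0"
  using assms(2) by (induction j arbitrary: n) (auto simp: assms(1))

lemma glauber_iter_add:
  "glauber_iter \<kappa> (\<lambda>n. a n + b n) j n = glauber_iter \<kappa> a j n + glauber_iter \<kappa> b j n"
  by (induction j arbitrary: n) (simp_all add: algebra_simps)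

lemma summable_bounded_exp_series:
  fixes c :: "nat \<Rightarrow> real"
  assumes "\<And>j. \<bar>c j\<bar> \<le> B"
  shows "summable (\<lambda>j. c j / fact j * t ^ j)"
proof (rule summable_comparison_test')
  show "summable (\<lambda>j. B * (inverse (fact j) * \<bar>t\<bar> ^ j))"
    by (intro summable_mult summable_exp)
next
  fix j :: nat
  assume "j \<ge> 0"
  have "\<bar>c j\<bar> * (inverse (fact j) * \<bar>t\<bar> ^ j) \<le> B * (inverse (fact j) * \<bar>t\<bar> ^ j)"
    by (intro mult_right_mono assms) auto
  then show "norm (c j / fact j * t ^ j) \<le> B * (inverse (fact j) * \<bar>t\<bar> ^ j)"
    by (simp add: abs_mult power_abs divide_inverse mult_ac)
qed

text \<open>The series is dominated by exp t, which \<open>exp (- t)\<close> cancels. The bound is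
  uniform in time and supplies the boundedness clause of \<open>glauber_sol\<close>.\<close>

lemma bounded_exp_series_bound:
  fixes c :: "nat \<Rightarrow> real"
  assumes "\<And>j. \<bar>c j\<bar> \<le> 1" "t \<ge> 0"
  shows "\<bar>exp (- t) * (\<Sum>j. c j / fact j * t ^ j)\<bar> \<le> 1"
proof -
  have "norm (\<Sum>j. c j / fact j * t ^ j) \<le> (\<Sum>j. inverse (fact j) * t ^ j)"
  proof (rule norm_suminf_le)
    show "norm (c j / fact j * t ^ j) \<le> inverse (fact j) * t ^ j" for j
      using mult_right_mono[OF assms(1)[of j], of "inverse (fact j) * t ^ j"] \<open>t \<ge> 0\<close>
      by (simp add: abs_mult power_abs divide_inverse mult_ac)
  qed (rule summable_exp)
  also have "\<dots> = exp t"
    by (simp add: exp_def scaleR_conv_of_real divide_inverse)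
  finally have "exp (- t) * \<bar>\<Sum>j. c j / fact j * t ^ j\<bar> \<le> exp (- t) * exp t"
    by (intro mult_left_mono) auto
  then show ?thesis
    by (simp add: abs_mult flip: exp_add)
qed

lemma glauber_flow_solution:
  assumes \<kappa>: "\<kappa> > 0" and a: "\<And>n. n \<ge> 1 \<Longrightarrow> \<bar>a n\<bar> \<le> 1"
  shows "glauber_sol \<kappa> (glauber_flow \<kappa> a)"
proof -
  note bd = glauber_iter_bound[OF \<kappa> a]
  let ?c = "\<lambda>n j. glauber_iter \<kappa> a j n / fact j"
  have summ: "summable (\<lambda>j. glauber_iter \<kappa> a (f j) n / fact j * t ^ j)" for f n t
    by (rule summable_bounded_exp_series[of _ 1]) (rule bd)
  \<comment> \<open>In the termwise derivative the factor j + 1 is absorbed by the factorial, which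
    leaves the iterates shifted by one.\<close>
  have diffs: "diffs (?c n) = (\<lambda>j. glauber_iter \<kappa> a (Suc j) n / fact j)" for n
    by (auto simp: diffs_def fun_eq_iff simp del: glauber_iter.simps of_nat_Suc)
  \<comment> \<open>Unfolding one iteration turns the shifted series into the two neighbouring
    flows, that is, into the coupling term.\<close>
  have rec: "exp (- t) * (\<Sum>j. glauber_iter \<kappa> a (Suc j) n / fact j * t ^ j) =
      gam \<kappa> n / 2 * (glauber_flow \<kappa> a (n - 1) t + glauber_flow \<kappa> a (n + 1) t)" for n t
  proof -
    have "(\<Sum>j. glauber_iter \<kappa> a (Suc j) n / fact j * t ^ j) =
        (\<Sum>j. gam \<kappa> n / 2 * (?c (n - 1) j * t ^ j + ?c (n + 1) j * t ^ j))"
      by (rule suminf_cong) (simp add: add_divide_distrib algebra_simps)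
    also have "\<dots> = gam \<kappa> n / 2 * ((\<Sum>j. ?c (n - 1) j * t ^ j) + (\<Sum>j. ?c (n + 1) j * t ^ j))"
      by (subst suminf_mult) (intro summable_add summ[of "\<lambda>j. j"] suminf_add[symmetric] arg_cong[where f = "(*) _"])+
    finally show ?thesis
      by (simp add: glauber_flow_def algebra_simps)
  qed
  have deriv: "((glauber_flow \<kappa> a n) has_real_derivative
      (- glauber_flow \<kappa> a n t + gam \<kappa> n / 2 * (glauber_flow \<kappa> a (n - 1) t + glauber_flow \<kappa> a (n + 1) t)))
      (at t)" for n t
  proof -
    have "((\<lambda>x. \<Sum>j. ?c n j * x ^ j) has_real_derivative (\<Sum>j. diffs (?c n) j * t ^ j)) (at t)"
      by (intro termdiffs_strong_converges_everywhere summ[of "\<lambda>j. j"])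
    then have "((\<lambda>x. exp (- x) * (\<Sum>j. ?c n j * x ^ j)) has_real_derivative
        (- exp (- t) * (\<Sum>j. ?c n j * t ^ j) + exp (- t) * (\<Sum>j. diffs (?c n) j * t ^ j))) (at t)"
      by (auto intro!: derivative_eq_intros)
    then show ?thesis
      unfolding diffs rec by (simp add: glauber_flow_def[abs_def])
  qed
  show ?thesis
    unfolding glauber_sol_def
  proof (intro conjI allI impI)
    show "glauber_flow \<kappa> a 0 t = 0" for t
      by (simp add: glauber_flow_def)
    show "((glauber_flow \<kappa> a n) has_real_derivative
      (- glauber_flow \<kappa> a n t + gam \<kappa> n / 2 * (glauber_flow \<kappa> a (n - 1) t + glauber_flow \<kappa> a (n + 1) t)))
      (at t within {0..})" for n t
      by (rule has_field_derivative_at_within[OF deriv])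
    show "\<exists>B. \<forall>n. \<forall>t\<in>{0..T}. \<bar>glauber_flow \<kappa> a n t\<bar> \<le> B" for T
      unfolding glauber_flow_def by (intro exI[of _ 1] allI ballI bounded_exp_series_bound bd) auto
  qed
qed

lemma glauber_flow_initial: "n \<ge> 1 \<Longrightarrow> glauber_flow \<kappa> a n 0 = a n"
  unfolding glauber_flow_def powser_zero by simp

section \<open>Uniqueness among solutions bounded on compact time intervals\<close>

lemma glauber_sol_diff:
  assumes "glauber_sol \<kappa> x" "glauber_sol \<kappa> y"
  shows "glauber_sol \<kappa> (\<lambda>n t. x n t - y n t)"
  unfolding glauber_sol_def
proof (intro conjI allI impI)
  fix n :: nat and t :: real
  assume "n \<ge> 1" "t \<ge> 0"
  then have "((x n) has_real_derivative (- x n t + gam \<kappa> n / 2 * (x (n - 1) t + x (n + 1) t))) (at t within {0..})"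
    "((y n) has_real_derivative (- y n t + gam \<kappa> n / 2 * (y (n - 1) t + y (n + 1) t))) (at t within {0..})"
    using assms unfolding glauber_sol_def by blast+
  from DERIV_diff[OF this]
  show "((\<lambda>t. x n t - y n t) has_real_derivative
      - (x n t - y n t) + gam \<kappa> n / 2 * (x (n - 1) t - y (n - 1) t + (x (n + 1) t - y (n + 1) t)))
      (at t within {0..})"
    by (simp add: algebra_simps)
next
  fix T :: real
  assume "T \<ge> 0"
  then obtain B C where "\<forall>n. \<forall>t\<in>{0..T}. \<bar>x n t\<bar> \<le> B" "\<forall>n. \<forall>t\<in>{0..T}. \<bar>y n t\<bar> \<le> C"
    using assms unfolding glauber_sol_def by meson
  then have "\<bar>x n t - y n t\<bar> \<le> B + C" if "t \<in> {0..T}" for n t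
    using that abs_triangle_ineq4[of "x n t" "y n t"] by (meson add_mono order_trans)
  then show "\<exists>B. \<forall>n. \<forall>t\<in>{0..T}. \<bar>x n t - y n t\<bar> \<le> B"
    by blast
next
  show "x 0 t - y 0 t = 0" if "t \<ge> 0" for t
    using that assms by (simp add: glauber_sol_def)
qed

text \<open>Picard iteration of an a priori bound: the derivative of each component is at most twice
  the current bound, and integrating from the initial value zero gains a factor 2 t / (m +
  1).\<close>

lemma glauber_sol_zero_bound:
  assumes \<kappa>: "\<kappa> > 0" and sol: "glauber_sol \<kappa> x"
    and init: "\<And>n. n \<ge> 1 \<Longrightarrow> x n 0 = 0"
    and B: "\<And>n t. t \<in> {0..T} \<Longrightarrow> \<bar>x n t\<bar> \<le> B"
    and t: "t \<in> {0..T}"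
  shows "\<bar>x n t\<bar> \<le> B * (2 * t) ^ m / fact m"
  using t
proof (induction m arbitrary: n t)
  case 0
  then show ?case using B by simp
next
  case (Suc m)
  have "0 \<le> B"
    using B[OF Suc.prems] abs_ge_zero order_trans by blast
  show ?case
  proof (cases "n = 0")
    case True
    then show ?thesis
      using sol Suc.prems \<open>0 \<le> B\<close> by (simp add: glauber_sol_def)
  next
    case False
    define x' where "x' s = - x n s + gam \<kappa> n / 2 * (x (n - 1) s + x (n + 1) s)" for s
    \<comment> \<open>\<open>b\<close> is the bound at level \<open>Suc m\<close>; its derivative
      \<open>b'\<close> is twice the bound at level \<open>m\<close>. The factor 2 counts one for
      the damping and one for the coupling, where \<open>gam \<kappa> n\<close> is at most
      1.\<close>
    define b where "b s = B * (2 * s) ^ Suc m / fact (Suc m)" for s :: real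
    define b' where "b' s = 2 * (B * (2 * s) ^ m / fact m)" for s :: real
    have x': "(x n has_real_derivative x' s) (at s within {0..t})" if "s \<in> {0..t}" for s
    proof (rule has_field_derivative_subset)
      show "(x n has_real_derivative x' s) (at s within {0..})"
        using sol False that unfolding glauber_sol_def x'_def by simp
    qed auto
    have b': "(b has_real_derivative b' s) (at s within {0..t})" for s
    proof -
      have "((\<lambda>s. B * (2 * s) ^ Suc m / fact (Suc m)) has_real_derivative
          B * (real (Suc m) * (2 * s) ^ m * 2) / fact (Suc m)) (at s within {0..t})"
        by (rule derivative_eq_intros refl | simp)+
      moreover have "B * (real (Suc m) * (2 * s) ^ m * 2) / fact (Suc m) = b' s"
        by (simp add: b'_def field_simps del: of_nat_Suc)
      ultimately show ?thesis
        by (simp add: b_def[abs_def] del: power_Suc of_nat_Suc fact_Suc)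
    qed
    have bound: "\<bar>x' s\<bar> \<le> b' s" if "s \<in> {0..t}" for s
    proof -
      have s: "s \<in> {0..T}"
        using that Suc.prems by auto
      let ?e = "B * (2 * s) ^ m / fact m"
      note IH = Suc.IH[OF s]
      have *: "\<bar>gam \<kappa> n / 2 * (x (n - 1) s + x (n + 1) s)\<bar> \<le> 1 / 2 * (2 * ?e)"
        unfolding abs_mult
        by (intro mult_mono order_trans[OF abs_triangle_ineq])
           (use gam_bounds[OF \<kappa>, of n] IH[of "n - 1"] IH[of "n + 1"] in auto)
      show ?thesis
        using * IH[of n] unfolding x'_def b'_def by linarith
    qed
    have pos: "0 \<le> t"
      using Suc.prems by simp
    \<comment> \<open>Integration is replaced by monotonicity: by \<open>bound\<close> the sum and
      the difference of \<open>b\<close> and \<open>x n\<close> are nondecreasing, and both vanish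
      at time 0. The cases needed are c = 1 and c = -1.\<close>
    have "b 0 + c * x n 0 \<le> b t + c * x n t" if "\<bar>c\<bar> \<le> 1" for c
    proof (rule DERIV_nonneg_imp_increasing_open[OF pos])
      have *: "((\<lambda>s. b s + c * x n s) has_real_derivative b' s + c * x' s) (at s within {0..t})"
        if "s \<in> {0..t}" for s
        by (intro DERIV_add DERIV_cmult b' x' that)
      then show "continuous_on {0..t} (\<lambda>s. b s + c * x n s)"
        by (rule DERIV_continuous_on)
      show "\<exists>y. ((\<lambda>s. b s + c * x n s) has_real_derivative y) (at s) \<and> 0 \<le> y" if "0 < s" "s < t" for s
      proof -
        have "\<bar>c * x' s\<bar> \<le> 1 * b' s"
          unfolding abs_mult by (intro mult_mono bound) (use that \<open>\<bar>c\<bar> \<le> 1\<close> in auto)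
        then have "0 \<le> b' s + c * x' s"
          by (simp add: abs_le_iff)
        then show ?thesis
          using *[of s] that by (auto simp: at_within_Icc_at)
      qed
    qed
    from this[of 1] this[of "-1"]
    have "b 0 + x n 0 \<le> b t + x n t" "b 0 - x n 0 \<le> b t - x n t"
      by auto
    moreover have "b 0 = 0" "x n 0 = 0"
      using init False by (auto simp: b_def)
    ultimately have "\<bar>x n t\<bar> \<le> b t"
      by auto
    then show ?thesis
      by (simp add: b_def)
  qed
qed

text \<open>Let m tend to infinity in the preceding bound: for fixed t the factorial beats the
  power.\<close>

lemma glauber_sol_zero:
  assumes \<kappa>: "\<kappa> > 0" and sol: "glauber_sol \<kappa> x"
    and init: "\<And>n. n \<ge> 1 \<Longrightarrow> x n 0 = 0" and t: "t \<ge> 0"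
  shows "x n t = 0"
proof -
  obtain B where B: "\<And>n s. s \<in> {0..t} \<Longrightarrow> \<bar>x n s\<bar> \<le> B"
    using sol t unfolding glauber_sol_def by blast
  have "(\<lambda>m. B * ((2 * t) ^ m / fact m)) \<longlonglongrightarrow> B * 0"
    using summable_LIMSEQ_zero[OF summable_exp[of "2 * t"]]
    by (intro tendsto_mult_left) (simp add: divide_inverse mult.commute)
  moreover have "\<bar>x n t\<bar> \<le> B * ((2 * t) ^ m / fact m)" for m
    using glauber_sol_zero_bound[OF \<kappa> sol init B, where n = n and m = m and t = t and T = t] t by simp
  ultimately have "\<bar>x n t\<bar> \<le> B * 0"
    by (intro LIMSEQ_le_const) auto
  then show ?thesis by simp
qed

lemma glauber_sol_unique:
  assumes "\<kappa> > 0" "glauber_sol \<kappa> x" "glauber_sol \<kappa> y"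
    and "\<And>n. n \<ge> 1 \<Longrightarrow> x n 0 = y n 0" "t \<ge> 0"
  shows "x n t = y n t"
  using glauber_sol_zero[OF assms(1) glauber_sol_diff[OF assms(2,3)], of t n] assms(4,5) by simp

text \<open>Superposition: partial sums are exactly flows of truncated data, and the discarded data
  enter only through a tail of the exponential series. The shift \<open>k + 1\<close> reconciles a
  sum starting at 0 with sites starting at 1.\<close>

lemma glauber_flow_unit_sums:
  assumes \<kappa>: "\<kappa> > 0" and a: "\<And>n. n \<ge> 1 \<Longrightarrow> \<bar>a n\<bar> \<le> 1"
  shows "(\<lambda>k. glauber_flow \<kappa> (\<lambda>n. if n = k + 1 then 1 else 0) n t * a (k + 1)) sums glauber_flow \<kappa> a n t"
proof -
  let ?\<delta> = "\<lambda>k n. if n = k + 1 then 1 else 0 :: real"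
  let ?low = "\<lambda>K n. if n \<le> K then a n else 0"
  let ?high = "\<lambda>K n. if n \<le> K then 0 else a n"
  have summ: "summable (\<lambda>j. glauber_iter \<kappa> b j n / fact j * t ^ j)" if "\<And>n. n \<ge> 1 \<Longrightarrow> \<bar>b n\<bar> \<le> 1" for b
    by (rule summable_bounded_exp_series[of _ 1]) (rule glauber_iter_bound[OF \<kappa> that])
  have summ\<delta>: "summable (\<lambda>j. glauber_iter \<kappa> (?\<delta> k) j n / fact j * t ^ j)" for k
    by (rule summ) auto
  have partial: "(\<Sum>k<K. glauber_flow \<kappa> (?\<delta> k) n t * a (k + 1)) = glauber_flow \<kappa> (?low K) n t" for K
  proof -
    have iter: "(\<Sum>k<K. glauber_iter \<kappa> (?\<delta> k) j m * a (k + 1)) = glauber_iter \<kappa> (?low K) j m" for j m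
    proof (induction j arbitrary: m)
      case 0
      show ?case
        by (cases m) (auto simp: if_distrib[of "\<lambda>x. x * _"] sum.delta cong: if_cong)
    next
      case (Suc j)
      have "(\<Sum>k<K. glauber_iter \<kappa> (?\<delta> k) (Suc j) m * a (k + 1)) = gam \<kappa> m / 2 *
          ((\<Sum>k<K. glauber_iter \<kappa> (?\<delta> k) j (m - 1) * a (k + 1)) + (\<Sum>k<K. glauber_iter \<kappa> (?\<delta> k) j (m + 1) * a (k + 1)))"
        by (simp add: sum.distrib sum_distrib_left algebra_simps)
      then show ?case
        unfolding Suc by simp
    qed
    have "(\<Sum>k<K. glauber_flow \<kappa> (?\<delta> k) n t * a (k + 1)) =
        exp (- t) * (\<Sum>k<K. \<Sum>j. glauber_iter \<kappa> (?\<delta> k) j n / fact j * t ^ j * a (k + 1))"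
      unfolding glauber_flow_def sum_distrib_left suminf_mult2[OF summ\<delta>, symmetric]
      by (simp add: mult.assoc)
    also have "(\<Sum>k<K. \<Sum>j. glauber_iter \<kappa> (?\<delta> k) j n / fact j * t ^ j * a (k + 1)) =
        (\<Sum>j. \<Sum>k<K. glauber_iter \<kappa> (?\<delta> k) j n / fact j * t ^ j * a (k + 1))"
      by (intro suminf_sum[symmetric] summable_mult2 summ) auto
    also have "\<dots> = (\<Sum>j. glauber_iter \<kappa> (?low K) j n / fact j * t ^ j)"
      by (intro suminf_cong) (simp add: iter[symmetric] sum_distrib_left sum_divide_distrib sum_distrib_right mult_ac)
    finally show ?thesis
      by (simp add: glauber_flow_def)
  qed
  have error: "\<bar>glauber_flow \<kappa> (?low K) n t - glauber_flow \<kappa> a n t\<bar> \<le>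
      exp (- t) * (\<Sum>j. inverse (fact (j + (K - n))) * \<bar>t\<bar> ^ (j + (K - n)))" if "n \<le> K" for K
  proof -
    let ?h = "\<lambda>j. glauber_iter \<kappa> (?high K) j n / fact j * t ^ j"
    have split: "glauber_iter \<kappa> a j n = glauber_iter \<kappa> (?low K) j n + glauber_iter \<kappa> (?high K) j n" for j
      unfolding glauber_iter_add[symmetric] by (intro arg_cong[where f = "\<lambda>f. glauber_iter \<kappa> f j n"]) auto
    have bh: "\<bar>glauber_iter \<kappa> (?high K) j n\<bar> \<le> 1" for j
      by (rule glauber_iter_bound[OF \<kappa>]) (use a in auto)
    have "(\<Sum>j. glauber_iter \<kappa> a j n / fact j * t ^ j) =
        (\<Sum>j. glauber_iter \<kappa> (?low K) j n / fact j * t ^ j) + (\<Sum>j. ?h j)"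
      unfolding split by (subst suminf_add[OF summ summ]) (use a in \<open>auto simp: add_divide_distrib distrib_right\<close>)
    moreover have "(\<Sum>j. ?h j) = (\<Sum>j. ?h (j + (K - n))) + (\<Sum>j<K - n. ?h j)"
      by (intro suminf_split_initial_segment summ) (use a in auto)
    \<comment> \<open>By finite propagation speed the first \<open>K - n\<close> iterates of the
      discarded data vanish at site \<open>n\<close>.\<close>
    moreover have "(\<Sum>j<K - n. ?h j) = 0"
      by (intro sum.neutral ballI, subst glauber_iter_eq_0[of K]) auto
    ultimately have eq: "\<bar>glauber_flow \<kappa> (?low K) n t - glauber_flow \<kappa> a n t\<bar> = exp (- t) * \<bar>\<Sum>j. ?h (j + (K - n))\<bar>"
      by (simp add: glauber_flow_def algebra_simps abs_mult)
    have "norm (\<Sum>j. ?h (j + (K - n))) \<le> (\<Sum>j. inverse (fact (j + (K - n))) * \<bar>t\<bar> ^ (j + (K - n)))"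
    proof (rule norm_suminf_le)
      show "norm (?h (j + (K - n))) \<le> inverse (fact (j + (K - n))) * \<bar>t\<bar> ^ (j + (K - n))" for j
        using mult_right_mono[OF bh[of "j + (K - n)"], of "inverse (fact (j + (K - n))) * \<bar>t\<bar> ^ (j + (K - n))"]
        by (simp add: abs_mult power_abs divide_inverse mult_ac)
      show "summable (\<lambda>j. inverse (fact (j + (K - n))) * \<bar>t\<bar> ^ (j + (K - n)))"
        by (rule summable_ignore_initial_segment[OF summable_exp])
    qed
    then show ?thesis
      unfolding eq by (intro mult_left_mono) auto
  qed
  have "(\<lambda>i. \<Sum>j. inverse (fact (j + i)) * \<bar>t\<bar> ^ (j + i)) \<longlonglongrightarrow> 0"
    by (intro suminf_exist_split2 summable_exp)
  then have "(\<lambda>K. \<Sum>j. inverse (fact (j + (K - n))) * \<bar>t\<bar> ^ (j + (K - n))) \<longlonglongrightarrow> 0"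
    by (rule filterlim_compose) (rule filterlim_minus_const_nat_at_top)
  then have "(\<lambda>K. exp (- t) * (\<Sum>j. inverse (fact (j + (K - n))) * \<bar>t\<bar> ^ (j + (K - n)))) \<longlonglongrightarrow> exp (- t) * 0"
    by (intro tendsto_mult_left)
  then have lim: "(\<lambda>K. exp (- t) * (\<Sum>j. inverse (fact (j + (K - n))) * \<bar>t\<bar> ^ (j + (K - n)))) \<longlonglongrightarrow> 0"
    by simp
  have "\<forall>\<^sub>F K in sequentially. norm (glauber_flow \<kappa> (?low K) n t - glauber_flow \<kappa> a n t) \<le>
      exp (- t) * (\<Sum>j. inverse (fact (j + (K - n))) * \<bar>t\<bar> ^ (j + (K - n)))"
    unfolding real_norm_def using eventually_ge_at_top[of n] by (rule eventually_mono) (rule error)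
  from Lim_null_comparison[OF this lim]
  have "(\<lambda>K. glauber_flow \<kappa> (?low K) n t - glauber_flow \<kappa> a n t) \<longlonglongrightarrow> 0" .
  then show ?thesis
    unfolding sums_def partial by (simp add: LIM_zero_iff)
qed

section \<open>The Jost solution\<close>

text \<open>The index \<open>i\<close> belongs to the exponent i + 1, and \<open>y\<close> stands
  for z^2.\<close>

definition jost_factor :: "real \<Rightarrow> nat \<Rightarrow> complex \<Rightarrow> complex" where
  "jost_factor q i y = (1 - of_real q ^ Suc i) * (1 - of_real q ^ Suc i * y) /
     ((1 + of_real q ^ Suc i) * (1 + of_real q ^ Suc i * y))"

definition jost_prod :: "real \<Rightarrow> complex \<Rightarrow> complex" where
  "jost_prod q y = (\<Prod>i. jost_factor q i y)"

text \<open>The product over all indices from \<open>j\<close> on, encoded as a quotient so that no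
  shifted infinite product is needed.\<close>

definition jost_tail :: "real \<Rightarrow> nat \<Rightarrow> complex \<Rightarrow> complex" where
  "jost_tail q j y = jost_prod q y / (\<Prod>i<j. jost_factor q i y)"

text \<open>The tail before index 0 is taken to be 0, so that the increments add up to the limit of
  the tails, which is 1.\<close>

definition jost_diff :: "real \<Rightarrow> nat \<Rightarrow> complex \<Rightarrow> complex" where
  "jost_diff q j y = jost_tail q j y - (if j = 0 then 0 else jost_tail q (j - 1) y)"

definition jost_series :: "real \<Rightarrow> nat \<Rightarrow> complex \<Rightarrow> complex" where
  "jost_series q n y = (\<Sum>j. jost_diff q j y * of_real q ^ (n * j))"

definition jost_solution :: "real \<Rightarrow> nat \<Rightarrow> complex \<Rightarrow> complex" where
  "jost_solution q n z = z ^ n * jost_series q n (z\<^sup>2)"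

locale nome =
  fixes q :: real
  assumes q_pos: "0 < q" and q_less_1: "q < 1"
begin

section \<open>The factors and their infinite product on the closed unit disc\<close>

lemma norm_q_power [simp]: "norm (of_real q ^ i :: 'a::real_normed_div_algebra) = q ^ i"
  using q_pos by (simp add: norm_power)

lemma q_power_Suc_less_1: "q ^ Suc i < 1"
  by (rule power_Suc_less_one[OF q_pos q_less_1])

lemma one_plus_q_power_mult_ne_0:
  fixes y :: complex
  assumes "norm y \<le> 1"
  shows "1 - q ^ Suc i \<le> norm (1 + of_real q ^ Suc i * y)" "1 + of_real q ^ Suc i * y \<noteq> 0"
    "1 - of_real q ^ Suc i * y \<noteq> 0"
proof -
  have le: "norm (of_real q ^ Suc i * y) \<le> q ^ Suc i"
    using assms q_pos unfolding norm_mult norm_q_power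
    by (metis less_imp_le mult.right_neutral mult_left_mono zero_less_power)
  show "1 - q ^ Suc i \<le> norm (1 + of_real q ^ Suc i * y)"
    using norm_triangle_ineq2[of 1 "- (of_real q ^ Suc i * y)"] le by simp
  have "of_real q ^ Suc i * y \<noteq> 1" "of_real q ^ Suc i * y \<noteq> - 1"
    using le q_power_Suc_less_1[of i] by (metis norm_minus_cancel norm_one not_le)+
  then show "1 + of_real q ^ Suc i * y \<noteq> 0" "1 - of_real q ^ Suc i * y \<noteq> 0"
    by (auto simp: add_eq_0_iff)
qed

lemma one_plus_q_power_ne_0:
  "1 + of_real q ^ Suc i \<noteq> (0 :: complex)" "1 - of_real q ^ Suc i \<noteq> (0 :: complex)"
  using one_plus_q_power_mult_ne_0[of 1 i] by simp_all

lemma jost_factor_ne_0: "norm y \<le> 1 \<Longrightarrow> jost_factor q i y \<noteq> 0"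
  unfolding jost_factor_def
  using one_plus_q_power_mult_ne_0[of y i] one_plus_q_power_ne_0[of i]
  by (simp del: power_Suc)

text \<open>The bounds pair crosswise: with p = q^(i+1), the numerator |1 - p y| is at most 1 + p
  and the denominator |1 + p y| is at least 1 - p.\<close>

lemma norm_jost_factor_le_1:
  assumes "norm y \<le> 1"
  shows "norm (jost_factor q i y) \<le> 1"
proof -
  define p where "p = q ^ Suc i"
  have p: "0 < p" "p < 1"
    using q_pos q_power_Suc_less_1[of i] by (simp_all add: p_def)
  have eq: "of_real q ^ Suc i = complex_of_real p"
    by (simp add: p_def)
  have [simp]: "norm (1 - complex_of_real p) = 1 - p" "norm (1 + complex_of_real p) = 1 + p"
    using p norm_of_real[of "1 - p", where 'a = complex] norm_of_real[of "1 + p", where 'a = complex] by simp_all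
  have "norm (of_real p * y) \<le> p"
    using assms p by (simp add: norm_mult mult_left_le)
  then have 1: "norm (1 - of_real p * y) \<le> 1 + p"
    using norm_triangle_ineq4[of 1 "of_real p * y"] by simp
  have 2: "1 - p \<le> norm (1 + of_real p * y)"
    using one_plus_q_power_mult_ne_0(1)[OF assms, of i] unfolding eq p_def[symmetric] .
  have "(1 - p) * norm (1 - of_real p * y) \<le> (1 - p) * (1 + p)"
    using 1 p by (intro mult_left_mono) auto
  also have "\<dots> \<le> norm (1 + of_real p * y) * (1 + p)"
    using 2 p by (intro mult_right_mono) auto
  finally have *: "(1 - p) * norm (1 - of_real p * y) \<le> (1 + p) * norm (1 + of_real p * y)"
    by (simp add: mult.commute)
  have "0 < norm (1 + of_real p * y)"
    using 2 p by linarith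
  then show ?thesis
    unfolding jost_factor_def eq norm_divide norm_mult using p *
    by (simp add: divide_le_eq_1)
qed

text \<open>Exposes the small factor q^(i+1), which makes the deviations summable, and the factor 1
  + y, which reappears in the recurrence of the series.\<close>

lemma one_minus_jost_factor:
  assumes "norm y \<le> 1"
  shows "1 - jost_factor q i y =
    2 * of_real q ^ Suc i * (1 + y) / ((1 + of_real q ^ Suc i) * (1 + of_real q ^ Suc i * y))"
  using one_plus_q_power_mult_ne_0(2)[OF assms, of i] one_plus_q_power_ne_0[of i]
  by (simp add: jost_factor_def divide_simps del: power_Suc) (simp add: algebra_simps del: power_Suc)

lemma norm_jost_factor_minus_1:
  assumes "norm y \<le> 1"
  shows "norm (jost_factor q i y - 1) \<le> 4 / (1 - q) * q ^ Suc i"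
proof -
  have [simp]: "norm (1 + complex_of_real q ^ Suc i) = 1 + q ^ Suc i"
    using q_pos norm_of_real[of "1 + q ^ Suc i", where 'a = complex] by (simp del: power_Suc)
  have "norm (jost_factor q i y - 1) = norm (1 - jost_factor q i y)"
    by (rule norm_minus_commute)
  also have "\<dots> = 2 * q ^ Suc i * norm (1 + y) / ((1 + q ^ Suc i) * norm (1 + of_real q ^ Suc i * y))"
    unfolding one_minus_jost_factor[OF assms] by (simp add: norm_divide norm_mult del: power_Suc)
  also have "\<dots> \<le> 2 * q ^ Suc i * 2 / (1 * (1 - q))"
  proof (intro frac_le mult_mono)
    show "norm (1 + y) \<le> 2"
      using norm_triangle_ineq[of 1 y] assms by simp
    have "q * q ^ i \<le> q * 1"
      using q_pos q_less_1 by (intro mult_left_mono) (auto simp: power_le_one)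
    then have "q ^ Suc i \<le> q"
      by simp
    with one_plus_q_power_mult_ne_0(1)[OF assms, of i]
    show "1 - q \<le> norm (1 + of_real q ^ Suc i * y)"
      by linarith
  qed (use q_pos q_less_1 in auto)
  finally show ?thesis by simp
qed

lemma continuous_on_jost_factor: "continuous_on (cball 0 1) (jost_factor q i)"
  unfolding jost_factor_def
  by (intro continuous_intros) (use one_plus_q_power_mult_ne_0 one_plus_q_power_ne_0 in \<open>auto simp del: power_Suc\<close>)

lemma holomorphic_on_jost_factor: "jost_factor q i holomorphic_on (ball 0 1)"
  unfolding jost_factor_def
  by (intro holomorphic_intros) (use one_plus_q_power_mult_ne_0 one_plus_q_power_ne_0 in \<open>auto simp del: power_Suc\<close>)

lemma summable_jost_bound: "summable (\<lambda>i. 4 / (1 - q) * q ^ Suc i)"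
  using q_pos q_less_1 by (intro summable_mult) (auto intro!: summable_mult summable_geometric)

lemma convergent_jost_prod:
  assumes "norm y \<le> 1"
  shows "convergent_prod (\<lambda>i. jost_factor q i y)"
proof -
  have "summable (\<lambda>i. norm (jost_factor q i y - 1))"
    by (rule summable_comparison_test'[OF summable_jost_bound]) (use norm_jost_factor_minus_1[OF assms] in simp)
  then show ?thesis
    by (intro abs_convergent_prod_imp_convergent_prod) (simp add: abs_convergent_prod_conv_summable)
qed

lemma jost_prod_ne_0: "norm y \<le> 1 \<Longrightarrow> jost_prod q y \<noteq> 0"
  unfolding jost_prod_def by (intro prodinf_nonzero convergent_jost_prod jost_factor_ne_0)

lemma jost_prod_LIMSEQ: "norm y \<le> 1 \<Longrightarrow> (\<lambda>N. \<Prod>i<N. jost_factor q i y) \<longlonglongrightarrow> jost_prod q y"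
  unfolding jost_prod_def
  using convergent_prod_LIMSEQ[OF convergent_jost_prod, of y]
  by (simp add: LIMSEQ_lessThan_iff_atMost)

text \<open>The deviations from 1 obey a summable bound independent of y. Uniformity up to the
  boundary matters: Cauchy's formula will be applied on the unit circle itself.\<close>

lemma uniform_limit_jost_prod:
  "uniform_limit (cball 0 1) (\<lambda>N y. \<Prod>i<N. jost_factor q i y) (jost_prod q) sequentially"
proof -
  have "uniformly_convergent_on (cball 0 1) (\<lambda>N y. \<Prod>i<N. jost_factor q i y)"
  proof (rule uniformly_convergent_on_prod')
    show "uniformly_convergent_on (cball 0 1) (\<lambda>N y. \<Sum>i<N. norm (jost_factor q i y - 1))"
      by (rule Weierstrass_m_test'[OF _ summable_jost_bound]) (use norm_jost_factor_minus_1 in simp)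
  qed (auto intro: continuous_on_jost_factor)
  then obtain l where l: "uniform_limit (cball 0 1) (\<lambda>N y. \<Prod>i<N. jost_factor q i y) l sequentially"
    by (auto simp: uniformly_convergent_on_def)
  have "l y = jost_prod q y" if "y \<in> cball 0 1" for y
    using tendsto_uniform_limitI[OF l that] jost_prod_LIMSEQ[of y] that LIMSEQ_unique by auto
  then show ?thesis
    using l by (subst uniform_limit_cong'[of _ _ "\<lambda>N y. \<Prod>i<N. jost_factor q i y" _ l]) auto
qed

lemma jost_prod_analytic:
  "continuous_on (cball 0 1) (jost_prod q)" "jost_prod q holomorphic_on ball 0 1"
proof -
  have "\<forall>\<^sub>F N in sequentially. continuous_on (cball 0 1) (\<lambda>y. \<Prod>i<N. jost_factor q i y) \<and>
      (\<lambda>y. \<Prod>i<N. jost_factor q i y) holomorphic_on ball 0 1"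
    by (intro always_eventually allI conjI continuous_on_prod continuous_on_jost_factor
        holomorphic_on_prod holomorphic_on_jost_factor)
  from holomorphic_uniform_limit[OF this uniform_limit_jost_prod]
  show "continuous_on (cball 0 1) (jost_prod q)" "jost_prod q holomorphic_on ball 0 1"
    by auto
qed

section \<open>Tails of the product and the Jost series\<close>

lemma jost_tail_0: "jost_tail q 0 y = jost_prod q y"
  by (simp add: jost_tail_def)

lemma jost_tail_Suc: "norm y \<le> 1 \<Longrightarrow> jost_tail q j y = jost_factor q j y * jost_tail q (Suc j) y"
  using jost_factor_ne_0[of y] by (simp add: jost_tail_def)

lemma jost_tail_tendsto_1:
  assumes "norm y \<le> 1"
  shows "(\<lambda>j. jost_tail q j y) \<longlonglongrightarrow> 1"
  unfolding jost_tail_def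
  using tendsto_divide[OF tendsto_const jost_prod_LIMSEQ[OF assms] jost_prod_ne_0[OF assms], of "jost_prod q y"]
    jost_prod_ne_0[OF assms] by simp

text \<open>Removing factors of modulus at most 1 can only increase the modulus, and the tails tend
  to 1.\<close>

lemma norm_jost_tail_le_1:
  assumes "norm y \<le> 1"
  shows "norm (jost_tail q j y) \<le> 1"
proof -
  have mono: "norm (jost_tail q j y) \<le> norm (jost_tail q (j + k) y)" for k
  proof (induction k)
    case (Suc k)
    have "norm (jost_tail q (j + k) y) \<le> 1 * norm (jost_tail q (Suc (j + k)) y)"
      unfolding jost_tail_Suc[OF assms, of "j + k"] norm_mult
      by (intro mult_right_mono norm_jost_factor_le_1 assms) auto
    with Suc show ?case by simp
  qed simp
  have "(\<lambda>k. norm (jost_tail q (k + j) y)) \<longlonglongrightarrow> norm (1 :: complex)"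
    by (intro tendsto_norm LIMSEQ_ignore_initial_segment jost_tail_tendsto_1 assms)
  then have "norm (jost_tail q j y) \<le> norm (1 :: complex)"
    by (rule LIMSEQ_le_const) (use mono in \<open>auto simp: add.commute\<close>)
  then show ?thesis by simp
qed

lemma jost_tail_analytic:
  "continuous_on (cball 0 1) (jost_tail q j)" "jost_tail q j holomorphic_on ball 0 1"
  unfolding jost_tail_def
  by (intro continuous_intros continuous_on_jost_factor jost_prod_analytic
      holomorphic_intros holomorphic_on_jost_factor; use jost_factor_ne_0 in auto)+

lemma jost_diff_0: "jost_diff q 0 y = jost_prod q y"
  by (simp add: jost_diff_def jost_tail_def)

lemma jost_diff_Suc: "jost_diff q (Suc j) y = jost_tail q (Suc j) y - jost_tail q j y"
  by (simp add: jost_diff_def)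

lemma norm_jost_diff_le_2:
  assumes "norm y \<le> 1"
  shows "norm (jost_diff q j y) \<le> 2"
proof (cases j)
  case 0
  then show ?thesis
    using norm_jost_tail_le_1[OF assms, of 0] by (simp add: jost_diff_def)
next
  case (Suc i)
  then show ?thesis
    using norm_triangle_ineq4[of "jost_tail q (Suc i) y" "jost_tail q i y"]
      norm_jost_tail_le_1[OF assms, of i] norm_jost_tail_le_1[OF assms, of "Suc i"]
    by (simp add: jost_diff_Suc)
qed

text \<open>This and the next lemma express the same increment through the tail at its upper or its
  lower index. Together they make the recurrence of the series telescope. At index 0 the convention
  in \<open>jost_diff\<close> makes the identity hold.\<close>

lemma jost_diff_upper:
  assumes "norm y \<le> 1"
  shows "jost_diff q j y * ((1 + of_real q ^ j) * (1 + of_real q ^ j * y)) =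
    2 * of_real q ^ j * (1 + y) * jost_tail q j y"
proof (cases j)
  case (Suc i)
  have "jost_diff q j y = (1 - jost_factor q i y) * jost_tail q j y"
    using jost_tail_Suc[OF assms, of i] by (simp add: Suc jost_diff_Suc algebra_simps)
  then show ?thesis
    unfolding one_minus_jost_factor[OF assms] Suc
    using one_plus_q_power_mult_ne_0(2)[OF assms, of i] one_plus_q_power_ne_0[of i]
    by (simp add: divide_simps del: power_Suc)
qed (simp add: jost_diff_0 jost_tail_0)

lemma jost_diff_lower:
  assumes "norm y \<le> 1"
  shows "jost_diff q (Suc j) y * ((1 - of_real q ^ Suc j) * (1 - of_real q ^ Suc j * y)) =
    2 * of_real q ^ Suc j * (1 + y) * jost_tail q j y"
proof -
  have *: "jost_diff q (Suc j) y = (1 - jost_factor q j y) * jost_tail q (Suc j) y"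
    using jost_tail_Suc[OF assms, of j] by (simp add: jost_diff_Suc algebra_simps)
  show ?thesis
    unfolding * one_minus_jost_factor[OF assms] jost_tail_Suc[OF assms, of j] jost_factor_def
    using one_plus_q_power_mult_ne_0[OF assms, of j] one_plus_q_power_ne_0[of j]
    by (simp add: divide_simps del: power_Suc) (simp add: algebra_simps del: power_Suc)
qed

lemma q_power_mult_le:
  assumes "n \<ge> 1"
  shows "q ^ (n * j) \<le> q ^ j"
  using assms q_pos q_less_1 by (intro power_decreasing) auto

lemma norm_jost_series_term:
  assumes "norm y \<le> 1" "n \<ge> 1"
  shows "norm (jost_diff q j y * of_real q ^ (n * j)) \<le> 2 * q ^ j"
  unfolding norm_mult norm_q_power
  by (intro mult_mono norm_jost_diff_le_2 q_power_mult_le assms) (use q_pos in auto)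

lemma summable_2_q: "summable (\<lambda>j. 2 * q ^ j)"
  using q_pos q_less_1 by (intro summable_mult summable_geometric) auto

text \<open>At n = 0 the geometric damping is absent; the sum converges because it
  telescopes.\<close>

lemma jost_series_0_sums:
  assumes "norm y \<le> 1"
  shows "(\<lambda>j. jost_diff q j y * of_real q ^ (0 * j)) sums 1"
proof -
  have "(\<lambda>j. jost_diff q (Suc j) y) sums (1 - jost_tail q 0 y)"
    unfolding jost_diff_Suc by (rule telescope_sums[OF jost_tail_tendsto_1[OF assms]])
  from sums_Suc[OF this] show ?thesis
    by (simp add: jost_diff_0 jost_tail_0)
qed

lemma jost_series_sums:
  assumes "norm y \<le> 1"
  shows "(\<lambda>j. jost_diff q j y * of_real q ^ (n * j)) sums jost_series q n y"
proof (cases "n = 0")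
  case True
  then show ?thesis
    using jost_series_0_sums[OF assms] unfolding jost_series_def by (metis sums_unique)
next
  case False
  then have "summable (\<lambda>j. jost_diff q j y * of_real q ^ (n * j))"
    using norm_jost_series_term[OF assms, of n]
    by (intro summable_comparison_test'[OF summable_2_q]) auto
  then show ?thesis
    unfolding jost_series_def by (rule summable_sums)
qed

lemma jost_series_0: "norm y \<le> 1 \<Longrightarrow> jost_series q 0 y = 1"
  using jost_series_0_sums[of y] jost_series_sums[of y 0] sums_unique2 by blast

text \<open>The difference of the two sides, taken term by term, is a telescoping difference of a
  sequence that starts at 0 and tends to 0.\<close>

lemma jost_series_recurrence:
  assumes "norm y \<le> 1"
  shows "(1 - of_real q ^ Suc n) * (y * jost_series q (Suc (Suc n)) y + jost_series q n y) =
    (1 + of_real q ^ Suc n) * (1 + y) * jost_series q (Suc n) y"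
proof -
  let ?Q = "complex_of_real q"
  let ?t = "\<lambda>n j. jost_diff q j y * ?Q ^ (n * j)"
  let ?s = "\<lambda>j. (1 - ?Q ^ Suc n) * (y * ?t (Suc (Suc n)) j + ?t n j) - (1 + ?Q ^ Suc n) * (1 + y) * ?t (Suc n) j"
  \<comment> \<open>The potential involves the tail at \<open>j - 1\<close>; its value 0 at
    \<open>j = 0\<close> is the convention that the tail before index 0 vanishes.\<close>
  define V where "V j = (if j = 0 then 0 else 2 * (1 + y) * ?Q ^ (Suc n * j) * jost_tail q (j - 1) y)" for j
  have Q: "?Q \<noteq> 0"
    using q_pos by simp
  have "?s sums ((1 - ?Q ^ Suc n) * (y * jost_series q (Suc (Suc n)) y + jost_series q n y) -
      (1 + ?Q ^ Suc n) * (1 + y) * jost_series q (Suc n) y)"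
    by (intro sums_diff sums_mult sums_add jost_series_sums assms)
  moreover have "?s j = V j - V (Suc j)" for j
  proof -
    have low: "?Q ^ j * V j = jost_diff q j y * ((1 - ?Q ^ j) * (1 - ?Q ^ j * y)) * ?Q ^ (Suc n * j)"
    proof (cases j)
      case (Suc i)
      show ?thesis
        unfolding Suc jost_diff_lower[OF assms] by (simp add: V_def)
    qed (simp add: V_def)
    have up: "?Q ^ j * V (Suc j) = jost_diff q j y * ((1 + ?Q ^ j) * (1 + ?Q ^ j * y)) * ?Q ^ (Suc n * Suc j)"
      unfolding jost_diff_upper[OF assms] by (simp add: V_def)
    \<comment> \<open>Writing Q for \<open>?Q\<close>, the increment in \<open>?s j\<close> carries
      the coefficient Q^(n j) ((1 - Q^j)(1 - Q^j y) - Q^(n+1) (1 + Q^j)(1 + Q^j y)). After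
      multiplication by Q^j its two parts are \<open>low\<close> and \<open>up\<close>.\<close>
    have "?Q ^ j * ?s j = ?Q ^ j * (V j - V (Suc j))"
      unfolding right_diff_distrib[of _ "V j"] low up
      by (simp add: power_add power_mult_distrib algebra_simps)
    then show ?thesis
      using Q by simp
  qed
  moreover have "(\<lambda>j. V j - V (Suc j)) sums (V 0 - 0)"
  proof (rule telescope_sums')
    have "(\<lambda>j. 4 * q ^ j) \<longlonglongrightarrow> 4 * 0"
      using q_pos q_less_1 by (intro tendsto_mult_left LIMSEQ_power_zero) simp
    then have lim: "(\<lambda>j. 4 * q ^ j) \<longlonglongrightarrow> 0"
      by simp
    have "norm (V j) \<le> 4 * q ^ j" for j
    proof (cases "j = 0")
      case False
      have "norm (V j) = 2 * norm (1 + y) * q ^ (Suc n * j) * norm (jost_tail q (j - 1) y)"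
        unfolding V_def norm_mult norm_q_power if_not_P[OF False] by simp
      also have "\<dots> \<le> 2 * 2 * q ^ j * 1"
        using norm_triangle_ineq[of 1 y] assms q_pos
        by (intro mult_mono norm_jost_tail_le_1 q_power_mult_le) auto
      finally show ?thesis by simp
    qed (simp add: V_def)
    then show "V \<longlonglongrightarrow> 0"
      by (intro Lim_null_comparison[OF _ lim]) auto
  qed
  ultimately show ?thesis
    using sums_unique2 by (fastforce simp: V_def)
qed

lemma jost_series_analytic:
  assumes "n \<ge> 1"
  shows "continuous_on (cball 0 1) (jost_series q n)" "jost_series q n holomorphic_on ball 0 1"
proof -
  let ?f = "\<lambda>N y. \<Sum>j<N. jost_diff q j y * of_real q ^ (n * j)"
  have diff: "continuous_on (cball 0 1) (jost_diff q j)" "jost_diff q j holomorphic_on ball 0 1" for j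
    unfolding jost_diff_def
    by (cases "j = 0"; auto intro!: continuous_intros holomorphic_intros jost_tail_analytic)+
  have "uniform_limit (cball 0 1) ?f (jost_series q n) sequentially"
    unfolding jost_series_def
    by (rule Weierstrass_m_test[OF _ summable_2_q]) (use norm_jost_series_term assms in auto)
  moreover have "\<forall>\<^sub>F N in sequentially. continuous_on (cball 0 1) (?f N) \<and> ?f N holomorphic_on ball 0 1"
    by (intro always_eventually allI conjI continuous_intros holomorphic_intros diff)
  ultimately show "continuous_on (cball 0 1) (jost_series q n)" "jost_series q n holomorphic_on ball 0 1"
    using holomorphic_uniform_limit[of 0 1 ?f sequentially "jost_series q n"] by auto
qed

text \<open>As n grows only the term with j = 0 survives; all others together are of order
  q^n.\<close>

lemma jost_series_tendsto:
  assumes "norm y \<le> 1"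
  shows "(\<lambda>n. jost_series q n y) \<longlonglongrightarrow> jost_prod q y"
proof -
  have bound: "norm (jost_series q n y - jost_prod q y) \<le> 2 * q ^ n / (1 - q)" if "n \<ge> 1" for n
  proof -
    let ?f = "\<lambda>j. jost_diff q j y * of_real q ^ (n * j)"
    have "(\<lambda>j. ?f (Suc j)) sums (jost_series q n y - jost_prod q y)"
      using jost_series_sums[OF assms, of n] by (subst sums_Suc_iff) (simp add: jost_diff_0)
    then have "jost_series q n y - jost_prod q y = (\<Sum>j. ?f (Suc j))"
      by (rule sums_unique)
    also have "norm \<dots> \<le> (\<Sum>j. 2 * q ^ n * q ^ j)"
    proof (rule norm_suminf_le)
      show "norm (?f (Suc j)) \<le> 2 * q ^ n * q ^ j" for j
      proof -
        have "norm (?f (Suc j)) \<le> 2 * q ^ (n * Suc j)"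
          unfolding norm_mult norm_q_power
          by (intro mult_right_mono norm_jost_diff_le_2 assms) (use q_pos in auto)
        also have "q ^ (n * Suc j) \<le> q ^ n * q ^ j"
          using q_power_mult_le[OF that, of j] q_pos by (simp add: power_add)
        finally show ?thesis by simp
      qed
    qed (use q_pos q_less_1 in \<open>auto intro!: summable_mult\<close>)
    also have "\<dots> = 2 * q ^ n / (1 - q)"
      using q_pos q_less_1 by (subst suminf_mult) (auto simp: suminf_geometric)
    finally show ?thesis .
  qed
  have "(\<lambda>n. 2 / (1 - q) * q ^ n) \<longlonglongrightarrow> 2 / (1 - q) * 0"
    using q_pos q_less_1 by (intro tendsto_mult_left LIMSEQ_power_zero) simp
  then have lim: "(\<lambda>n. 2 * q ^ n / (1 - q)) \<longlonglongrightarrow> 0"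
    by simp
  have "(\<lambda>n. jost_series q n y - jost_prod q y) \<longlonglongrightarrow> 0"
    by (intro Lim_null_comparison[OF eventually_mono[OF eventually_ge_at_top[of 1] bound] lim])
  then show ?thesis
    by (simp add: LIM_zero_iff)
qed

text \<open>On the unit circle z * 2 Re z = 1 + z^2, so the recurrence in y = z^2 becomes a
  three-term recurrence with real coefficients.\<close>

lemma jost_solution_recurrence:
  assumes "norm z = 1"
  shows "(1 - of_real q ^ Suc n) * (jost_solution q (Suc (Suc n)) z + jost_solution q n z) =
    (1 + of_real q ^ Suc n) * (2 * of_real (Re z)) * jost_solution q (Suc n) z"
proof -
  have "2 * of_real (Re z) = z + cnj z"
    by (simp add: complex_add_cnj)
  moreover have "z * cnj z = 1"
    using assms by (simp add: complex_norm_square[symmetric])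
  ultimately have x: "z * (2 * of_real (Re z)) = 1 + z\<^sup>2"
    by (simp add: algebra_simps power2_eq_square)
  have "norm (z\<^sup>2) \<le> 1"
    using assms by (simp add: norm_power)
  note rec = jost_series_recurrence[OF this, of n]
  have "(1 - of_real q ^ Suc n) * (jost_solution q (Suc (Suc n)) z + jost_solution q n z) =
      z ^ n * ((1 - of_real q ^ Suc n) * (z\<^sup>2 * jost_series q (Suc (Suc n)) (z\<^sup>2) + jost_series q n (z\<^sup>2)))"
    by (simp add: jost_solution_def power2_eq_square algebra_simps)
  also have "\<dots> = (1 + of_real q ^ Suc n) * (2 * of_real (Re z)) * jost_solution q (Suc n) z"
    unfolding rec x[symmetric] by (simp add: jost_solution_def)
  finally show ?thesis .
qed

lemma jost_solution_0: "norm z = 1 \<Longrightarrow> jost_solution q 0 z = 1"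
  by (simp add: jost_solution_def jost_series_0 norm_power)

text \<open>The Wronskian of the solution and its conjugate is constant in \<^term>\<open>n\<close>;
  comparing its value at 0 with its limit at infinity gives the spectral density.\<close>

lemma Im_jost_solution_1:
  assumes "norm z = 1"
  shows "Im (jost_solution q 1 z) = Im z * (norm (jost_prod q (z\<^sup>2)))\<^sup>2"
proof -
  let ?m = "\<lambda>n. jost_solution q n z"
  define W where "W n = Im (?m (Suc n) * cnj (?m n))" for n
  have step: "W (Suc n) = W n" for n
  proof -
    have q: "1 - complex_of_real q ^ Suc n \<noteq> 0" "1 - q ^ Suc n \<noteq> 0"
      using one_plus_q_power_ne_0[of n] q_power_Suc_less_1[of n] by auto
    \<comment> \<open>Since \<open>c\<close> is real, the contribution of c |m_(n+1)|^2 to the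
      Wronskian has no imaginary part.\<close>
    define c where "c = (1 + q ^ Suc n) * (2 * Re z) / (1 - q ^ Suc n)"
    have "(1 - of_real q ^ Suc n) * (?m (Suc (Suc n)) + ?m n) = (1 - of_real q ^ Suc n) * (of_real c * ?m (Suc n))"
      unfolding jost_solution_recurrence[OF assms, of n] using q by (simp add: c_def del: power_Suc)
    then have "?m (Suc (Suc n)) + ?m n = of_real c * ?m (Suc n)"
      using q(1) mult_left_cancel by blast
    then have *: "?m (Suc (Suc n)) = of_real c * ?m (Suc n) - ?m n"
      by (simp add: algebra_simps)
    show ?thesis
      unfolding W_def * by (simp add: algebra_simps)
  qed
  have W: "W n = W 0" for n
    by (induction n) (simp_all add: step)
  have z2: "norm (z\<^sup>2) \<le> 1"
    using assms by (simp add: norm_power)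
  \<comment> \<open>On the circle the powers of z and of its conjugate cancel up to a single z, so
    the limit can be taken in the series alone.\<close>
  have Wn: "W n = Im (z * (jost_series q (Suc n) (z\<^sup>2) * cnj (jost_series q n (z\<^sup>2))))" for n
  proof -
    have "?m (Suc n) * cnj (?m n) = (z * cnj z) ^ n * (z * (jost_series q (Suc n) (z\<^sup>2) * cnj (jost_series q n (z\<^sup>2))))"
      by (simp add: jost_solution_def power_mult_distrib)
    also have "z * cnj z = 1"
      using assms by (simp add: complex_norm_square[symmetric])
    finally show ?thesis
      by (simp add: W_def)
  qed
  have "(\<lambda>n. W n) \<longlonglongrightarrow> Im (z * (jost_prod q (z\<^sup>2) * cnj (jost_prod q (z\<^sup>2))))"
    unfolding Wn by (intro tendsto_intros jost_series_tendsto[OF z2] LIMSEQ_Suc)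
  moreover have "(\<lambda>n. W n) \<longlonglongrightarrow> W 0"
    by (rule tendsto_eventually, rule always_eventually, rule allI, rule W)
  ultimately have "W 0 = Im (z * (jost_prod q (z\<^sup>2) * cnj (jost_prod q (z\<^sup>2))))"
    using LIMSEQ_unique by blast
  also have "\<dots> = Im z * (norm (jost_prod q (z\<^sup>2)))\<^sup>2"
    unfolding complex_norm_square[symmetric] by (simp del: of_real_power)
  finally show ?thesis
    by (simp add: W_def jost_solution_0[OF assms])
qed

end

section \<open>The polynomials and their orthogonality\<close>

definition ratio_coeff :: "real \<Rightarrow> nat \<Rightarrow> real" where
  "ratio_coeff q k = qpoch (- q) q k / qpoch q q k"

text \<open>For n \<ge> 1 this is the continuous q-ultraspherical (Rogers) polynomial of degree n -
  1 in cos \<theta> with parameter -q.\<close>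

definition Dpol :: "real \<Rightarrow> nat \<Rightarrow> real \<Rightarrow> real" where
  "Dpol q n \<theta> = (\<Sum>k<n. ratio_coeff q k * ratio_coeff q (n - 1 - k) * cos ((2 * real k - real n + 1) * \<theta>))"

definition spectral_density :: "real \<Rightarrow> real \<Rightarrow> real" where
  "spectral_density q \<theta> = (norm (jost_prod q ((cis \<theta>)\<^sup>2)))\<^sup>2"

definition qgam :: "real \<Rightarrow> nat \<Rightarrow> real" where
  "qgam q n = (1 - q ^ n) / (1 + q ^ n)"

text \<open>Both sides are written in the monomials u^k v^(n+1-k), using uv = 1 to raise the degree
  of \<open>E n\<close>, and their coefficients are compared.\<close>

lemma symmetric_convolution_recurrence:
  fixes u v :: "'a :: field" and c :: "nat \<Rightarrow> 'a"
  defines "E \<equiv> \<lambda>n. \<Sum>k<n. c k * c (n - 1 - k) * (u ^ k * v ^ (n - 1 - k))"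
  assumes uv: "u * v = 1"
    and c: "\<And>k. (1 - q ^ Suc k) * c (Suc k) = (1 + q ^ Suc k) * c k"
    and ne: "\<And>k. q ^ Suc k \<noteq> 1"
  shows "(1 - q ^ Suc n) * (E (Suc (Suc n)) + E n) = (1 + q ^ Suc n) * ((u + v) * E (Suc n))"
proof -
  \<comment> \<open>\<open>d\<close> is \<open>c\<close> shifted by one with d 0 = 0. The shift
    encodes multiplication by u or v and lets all four sums run over the same range.\<close>
  define d where "d k = (if k = 0 then 0 else c (k - 1))" for k
  let ?m = "\<lambda>k. u ^ k * v ^ (Suc n - k)"
  have E2: "E (Suc (Suc n)) = (\<Sum>k\<le>Suc n. c k * c (Suc n - k) * ?m k)"
    by (simp only: E_def lessThan_Suc_atMost diff_Suc_1)
  have uE: "u * E (Suc n) = (\<Sum>k\<le>Suc n. d k * c (Suc n - k) * ?m k)"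
    by (subst sum.atMost_Suc_shift)
       (simp add: E_def d_def lessThan_Suc_atMost sum_distrib_left mult_ac del: sum.lessThan_Suc sum.atMost_Suc)
  have vE: "v * E (Suc n) = (\<Sum>k\<le>Suc n. c k * d (Suc n - k) * ?m k)"
  proof -
    have "v * E (Suc n) = (\<Sum>k\<le>n. c k * d (Suc n - k) * ?m k)"
      unfolding E_def lessThan_Suc_atMost diff_Suc_1 sum_distrib_left
      by (intro sum.cong refl) (simp add: d_def Suc_diff_le mult_ac)
    then show ?thesis
      by (simp add: d_def)
  qed
  have E0: "E n = (\<Sum>k\<le>Suc n. d k * d (Suc n - k) * ?m k)"
  proof -
    have "E n = (u * v) * E n"
      by (simp add: uv)
    also have "\<dots> = (\<Sum>k<n. d (Suc k) * d (n - k) * ?m (Suc k))"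
      unfolding E_def sum_distrib_left
    proof (intro sum.cong refl)
      fix k assume "k \<in> {..<n}"
      then obtain l where l: "n = Suc (k + l)"
        using less_imp_Suc_add by auto
      show "u * v * (c k * c (n - 1 - k) * (u ^ k * v ^ (n - 1 - k))) = d (Suc k) * d (n - k) * ?m (Suc k)"
        by (simp add: d_def l mult_ac)
    qed
    also have "\<dots> = (\<Sum>k\<le>n. d (Suc k) * d (n - k) * ?m (Suc k))"
      by (simp add: lessThan_Suc_atMost[symmetric] d_def)
    finally show ?thesis
      by (subst sum.atMost_Suc_shift) (simp add: d_def)
  qed
  have coeff: "(1 - q ^ Suc n) * (c k * c (Suc n - k) + d k * d (Suc n - k)) =
      (1 + q ^ Suc n) * (d k * c (Suc n - k) + c k * d (Suc n - k))" if "k \<le> Suc n" for k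
  \<comment> \<open>At the ends k = 0 and k = n + 1 only one product survives on each side, and the
    claim is the ratio relation for \<open>c\<close>.\<close>
  proof (cases k)
    case 0
    then show ?thesis
      using c[of n] by (simp add: d_def)
  next
    case ki: (Suc i)
    show ?thesis
    proof (cases "n - i")
      case 0
      then have "i = n"
        using that ki by simp
      then show ?thesis
        using c[of n] by (simp add: ki d_def)
    next
      case (Suc j)
      have n: "Suc n = Suc i + Suc j" and nk: "Suc n - Suc i = Suc j"
        using Suc that ki by auto
      define a b where "a = q ^ Suc i" and "b = q ^ Suc j"
      have ab: "a \<noteq> 1" "b \<noteq> 1"
        using ne by (simp_all add: a_def b_def del: power_Suc)
      have ci: "c (Suc i) = (1 + a) / (1 - a) * c i" and cj: "c (Suc j) = (1 + b) / (1 - b) * c j"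
        using c[of i] c[of j] ab by (simp_all add: a_def b_def field_simps del: power_Suc)
      have qn: "q ^ Suc n = a * b"
        unfolding n power_add a_def b_def ..
      \<comment> \<open>This is the addition theorem of coth: with a = exp (-2x) the quotient (1 +
        a) / (1 - a) is coth x.\<close>
      have "(1 - a * b) * ((1 + a) / (1 - a) * ((1 + b) / (1 - b)) + 1) =
          (1 + a * b) * ((1 + b) / (1 - b) + (1 + a) / (1 - a))"
        using ab by (simp add: divide_simps) (simp add: algebra_simps)
      then have "c i * c j * ((1 - a * b) * ((1 + a) / (1 - a) * ((1 + b) / (1 - b)) + 1)) =
          c i * c j * ((1 + a * b) * ((1 + b) / (1 - b) + (1 + a) / (1 - a)))"
        by simp
      then show ?thesis
        unfolding qn ki nk ci cj d_def by (simp add: algebra_simps)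
    qed
  qed
  have "(1 - q ^ Suc n) * (E (Suc (Suc n)) + E n) =
      (\<Sum>k\<le>Suc n. (1 - q ^ Suc n) * (c k * c (Suc n - k) + d k * d (Suc n - k)) * ?m k)"
    unfolding E2 E0 sum.distrib[symmetric] sum_distrib_left
    by (intro sum.cong refl) (simp only: distrib_left distrib_right mult.assoc)
  also have "\<dots> = (\<Sum>k\<le>Suc n. (1 + q ^ Suc n) * (d k * c (Suc n - k) + c k * d (Suc n - k)) * ?m k)"
    by (intro sum.cong refl) (simp only: coeff atMost_iff)
  also have "\<dots> = (1 + q ^ Suc n) * (u * E (Suc n) + v * E (Suc n))"
    unfolding uE vE sum.distrib[symmetric] sum_distrib_left
    by (intro sum.cong refl) (simp only: distrib_left distrib_right mult.assoc)
  finally show ?thesis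
    by (simp only: distrib_right)
qed

section \<open>Recurrence of the polynomials\<close>

context nome
begin

lemma qgam_0: "qgam q 0 = 0"
  by (simp add: qgam_def)

lemma q_power_pos: "0 < q ^ n"
  using q_pos by simp

lemma qgam_Suc_pos: "0 < qgam q (Suc n)"
  unfolding qgam_def by (intro divide_pos_pos) (use q_power_pos[of "Suc n"] q_power_Suc_less_1[of n] in auto)

lemma ratio_coeff_Suc: "(1 - q ^ Suc k) * ratio_coeff q (Suc k) = (1 + q ^ Suc k) * ratio_coeff q k"
proof -
  have "1 - q ^ Suc k \<noteq> 0"
    using q_power_Suc_less_1[of k] by simp
  then show ?thesis
    by (simp add: ratio_coeff_def qpoch_def)
qed

text \<open>Puts the cosine sum in the shape of the convolution lemma, with u =
  \<open>cis \<theta>\<close> and v = \<open>cis (- \<theta>)\<close>, whose product is 1.\<close>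

lemma Dpol_eq_Re:
  "Dpol q n \<theta> = Re (\<Sum>k<n. of_real (ratio_coeff q k) * of_real (ratio_coeff q (n - 1 - k)) *
     (cis \<theta> ^ k * cis (- \<theta>) ^ (n - 1 - k)))"
  unfolding Dpol_def Re_sum
proof (intro sum.cong refl)
  fix k assume "k \<in> {..<n}"
  then have "real (n - 1 - k) = real n - 1 - real k"
    by (simp add: of_nat_diff)
  then have "real k * \<theta> + real (n - 1 - k) * (- \<theta>) = (2 * real k - real n + 1) * \<theta>"
    by (simp only:) (simp add: algebra_simps)
  moreover have "cis \<theta> ^ k * cis (- \<theta>) ^ (n - 1 - k) = cis (real k * \<theta> + real (n - 1 - k) * (- \<theta>))"
    by (simp only: Complex.DeMoivre cis_mult)
  ultimately have "cis \<theta> ^ k * cis (- \<theta>) ^ (n - 1 - k) = cis ((2 * real k - real n + 1) * \<theta>)"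
    by simp
  then show "ratio_coeff q k * ratio_coeff q (n - 1 - k) * cos ((2 * real k - real n + 1) * \<theta>) =
      Re (of_real (ratio_coeff q k) * of_real (ratio_coeff q (n - 1 - k)) *
        (cis \<theta> ^ k * cis (- \<theta>) ^ (n - 1 - k)))"
    by (simp flip: of_real_mult)
qed

lemma Dpol_0: "Dpol q 0 \<theta> = 0" and Dpol_1: "Dpol q (Suc 0) \<theta> = 1"
  by (simp_all add: Dpol_def ratio_coeff_def qpoch_def)

lemma Dpol_recurrence:
  "(1 - q ^ Suc n) * (Dpol q (Suc (Suc n)) \<theta> + Dpol q n \<theta>) = (1 + q ^ Suc n) * (2 * cos \<theta> * Dpol q (Suc n) \<theta>)"
proof -
  define E where "E n = (\<Sum>k<n. complex_of_real (ratio_coeff q k) * of_real (ratio_coeff q (n - 1 - k)) *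
     (cis \<theta> ^ k * cis (- \<theta>) ^ (n - 1 - k)))" for n
  have "(1 - of_real q ^ Suc n) * (E (Suc (Suc n)) + E n) =
      (1 + of_real q ^ Suc n) * ((cis \<theta> + cis (- \<theta>)) * E (Suc n))"
    unfolding E_def
  proof (rule symmetric_convolution_recurrence)
    show "(1 - complex_of_real q ^ Suc k) * of_real (ratio_coeff q (Suc k)) =
        (1 + of_real q ^ Suc k) * of_real (ratio_coeff q k)" for k
      using arg_cong[OF ratio_coeff_Suc[of k], of complex_of_real] by simp
    show "complex_of_real q ^ Suc k \<noteq> 1" for k
      using one_plus_q_power_ne_0(2)[of k] by (metis diff_self)
  qed (simp add: cis_mult)
  moreover have "cis \<theta> + cis (- \<theta>) = of_real (2 * cos \<theta>)"
    by (simp add: complex_eq_iff)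
  ultimately have "of_real (1 - q ^ Suc n) * (E (Suc (Suc n)) + E n) =
      of_real (1 + q ^ Suc n) * (of_real (2 * cos \<theta>) * E (Suc n))"
    by simp
  from arg_cong[OF this, of Re] show ?thesis
    unfolding Dpol_eq_Re E_def[symmetric] by (simp del: of_real_add of_real_diff of_real_mult)
qed

lemma cos_mult_Dpol: "cos \<theta> * Dpol q n \<theta> = qgam q n / 2 * (Dpol q (n - 1) \<theta> + Dpol q (n + 1) \<theta>)"
proof (cases n)
  case (Suc m)
  have "2 * (1 + q ^ Suc m) \<noteq> 0"
    using q_power_pos[of "Suc m"] by (simp del: power_Suc)
  moreover have "cos \<theta> * Dpol q n \<theta> * (2 * (1 + q ^ Suc m)) = (1 - q ^ Suc m) * (Dpol q (n - 1) \<theta> + Dpol q (n + 1) \<theta>)"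
  proof -
    have "cos \<theta> * Dpol q n \<theta> * (2 * (1 + q ^ Suc m)) = (1 + q ^ Suc m) * (2 * cos \<theta> * Dpol q (Suc m) \<theta>)"
      unfolding Suc by (simp only: mult_ac)
    then show ?thesis
      unfolding Dpol_recurrence[symmetric] by (simp add: Suc add.commute del: power_Suc)
  qed
  ultimately have "cos \<theta> * Dpol q n \<theta> = (1 - q ^ Suc m) * (Dpol q (n - 1) \<theta> + Dpol q (n + 1) \<theta>) / (2 * (1 + q ^ Suc m))"
    by (rule iffD2[OF nonzero_eq_divide_eq])
  then show ?thesis
    by (simp add: Suc qgam_def mult.commute del: power_Suc)
qed (simp add: Dpol_0 qgam_0)

lemma continuous_on_Dpol [continuous_intros]: "continuous_on A (Dpol q n)"
  unfolding Dpol_def by (intro continuous_intros)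

lemma continuous_on_spectral_density [continuous_intros]: "continuous_on A (spectral_density q)"
  unfolding spectral_density_def
  by (intro continuous_intros continuous_on_compose2[OF jost_prod_analytic(1)]) (auto simp: norm_power)

section \<open>Imaginary part of the Jost solution and orthogonality\<close>

lemma jost_prod_cnj:
  assumes "norm y \<le> 1"
  shows "jost_prod q (cnj y) = cnj (jost_prod q y)"
proof (rule LIMSEQ_unique)
  show "(\<lambda>N. \<Prod>i<N. jost_factor q i (cnj y)) \<longlonglongrightarrow> jost_prod q (cnj y)"
    using assms by (intro jost_prod_LIMSEQ) simp
  have "(\<Prod>i<N. jost_factor q i (cnj y)) = cnj (\<Prod>i<N. jost_factor q i y)" for N
    by (simp add: jost_factor_def)
  then show "(\<lambda>N. \<Prod>i<N. jost_factor q i (cnj y)) \<longlonglongrightarrow> cnj (jost_prod q y)"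
    using tendsto_cnj[OF jost_prod_LIMSEQ[OF assms]] by simp
qed

text \<open>Both sides solve the same three-term recurrence in n and agree at n = 0 and n = 1, the
  latter by the Wronskian identity.\<close>

lemma Im_jost_solution: "Im (jost_solution q n (cis \<theta>)) = Dpol q n \<theta> * (sin \<theta> * spectral_density q \<theta>)"
proof -
  let ?m = "\<lambda>n. Im (jost_solution q n (cis \<theta>))" and ?s = "sin \<theta> * spectral_density q \<theta>"
  have "?m n = Dpol q n \<theta> * ?s \<and> ?m (Suc n) = Dpol q (Suc n) \<theta> * ?s"
  proof (induction n)
    case 0
    then show ?case
      using Im_jost_solution_1[of "cis \<theta>"] by (simp add: Dpol_0 Dpol_1 jost_solution_0 spectral_density_def)
  next
    case (Suc n)
    have "of_real (1 - q ^ Suc n) * (jost_solution q (Suc (Suc n)) (cis \<theta>) + jost_solution q n (cis \<theta>)) =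
        of_real ((1 + q ^ Suc n) * (2 * cos \<theta>)) * jost_solution q (Suc n) (cis \<theta>)"
      using jost_solution_recurrence[of "cis \<theta>" n] by simp
    from arg_cong[OF this, of Im]
    have "(1 - q ^ Suc n) * (?m (Suc (Suc n)) + ?m n) = (1 + q ^ Suc n) * (2 * cos \<theta> * ?m (Suc n))"
      by (simp add: mult.assoc del: of_real_add of_real_diff of_real_mult of_real_power power_Suc)
    also have "\<dots> = (1 - q ^ Suc n) * (Dpol q (Suc (Suc n)) \<theta> + Dpol q n \<theta>) * ?s"
      unfolding Dpol_recurrence using Suc by simp
    finally have "?m (Suc (Suc n)) + ?m n = (Dpol q (Suc (Suc n)) \<theta> + Dpol q n \<theta>) * ?s"
      using q_power_Suc_less_1[of n] by simp
    then show ?case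
      using Suc by (simp add: algebra_simps)
  qed
  then show ?thesis ..
qed

text \<open>On the unit circle -2 sin \<theta> Im m_n is the real part of a function analytic in the
  disc, so Cauchy's formula reduces the integral to its value at 0.\<close>

lemma jost_solution_full_circle:
  assumes "n \<ge> 1"
  shows "((\<lambda>\<theta>. sin \<theta> * Im (jost_solution q n (cis \<theta>))) has_integral (if n = 1 then pi * qgam q 1 else 0)) {0..2 * pi}"
proof -
  \<comment> \<open>This is (z - 1/z) m_n(z), with the pole cancelled by means of n \<ge> 1. The
    remaining factor z^(n-1) makes it vanish at 0 unless n = 1.\<close>
  define f where "f z = (z\<^sup>2 - 1) * (z ^ (n - 1) * jost_series q n (z\<^sup>2))" for z
  have sq: "(\<lambda>z::complex. z\<^sup>2) ` cball 0 1 \<subseteq> cball 0 1" "(\<lambda>z::complex. z\<^sup>2) ` ball 0 1 \<subseteq> ball 0 1"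
    by (auto simp: norm_power power_le_one power_less_one_iff abs_square_less_1)
  have "continuous_on (cball 0 1) f"
    unfolding f_def
    by (intro continuous_intros continuous_on_compose2[OF jost_series_analytic(1)[OF assms]] sq)
  moreover have "f holomorphic_on ball 0 1"
    unfolding f_def
    by (intro holomorphic_intros holomorphic_on_compose_gen[OF _ jost_series_analytic(2)[OF assms], unfolded o_def] sq)
  ultimately have "((\<lambda>u. f u / (u - 0)) has_contour_integral (2 * of_real pi * \<i> * f 0)) (circlepath 0 1)"
    by (intro Cauchy_integral_circlepath) auto
  then have "((\<lambda>t. f (cis t) / cis t * \<i> * cis t) has_integral (2 * of_real pi * \<i> * f 0)) {0..2 * pi}"
    unfolding circlepath_def by (subst (asm) has_contour_integral_part_circlepath_iff) auto
  then have "((\<lambda>t. \<i> * f (cis t)) has_integral (2 * of_real pi * \<i> * f 0)) {0..2 * pi}"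
    by (simp add: mult.commute)
  from has_integral_Im[OF this]
  have "((\<lambda>t. Re (f (cis t))) has_integral (2 * pi * Re (f 0))) {0..2 * pi}"
    by simp
  moreover have "Re (f (cis t)) = - 2 * (sin t * Im (jost_solution q n (cis t)))" for t
  proof -
    obtain m where m: "n = Suc m"
      using assms by (cases n) auto
    have "(cis t - cis (- t)) * jost_solution q n (cis t) =
        (cis t * cis t - cis t * cis (- t)) * (cis t ^ m * jost_series q n ((cis t)\<^sup>2))"
      unfolding m jost_solution_def power_Suc by (simp only: algebra_simps)
    also have "\<dots> = f (cis t)"
      unfolding f_def by (simp add: m power2_eq_square cis_mult)
    finally have "f (cis t) = (cis t - cis (- t)) * jost_solution q n (cis t)" ..
    also have "cis t - cis (- t) = \<i> * of_real (2 * sin t)"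
      by (simp add: complex_eq_iff)
    finally show ?thesis
      by simp
  qed
  ultimately have "((\<lambda>t. - 2 * (sin t * Im (jost_solution q n (cis t)))) has_integral (2 * pi * Re (f 0))) {0..2 * pi}"
    by simp
  from has_integral_mult_right[OF this, of "-1/2"]
  have *: "((\<lambda>t. sin t * Im (jost_solution q n (cis t))) has_integral (- pi * Re (f 0))) {0..2 * pi}"
    by simp
  have "1 + complex_of_real q \<noteq> 0"
    using one_plus_q_power_ne_0(1)[of 0] by simp
  \<comment> \<open>The recurrence at y = 0 and n = 0 links this value to
    \<open>jost_series q 0 0 = 1\<close>.\<close>
  then have "jost_series q 1 0 = of_real (qgam q 1)"
    using jost_series_recurrence[of 0 0] by (simp add: jost_series_0 qgam_def field_simps)
  then have "- pi * Re (f 0) = (if n = 1 then pi * qgam q 1 else 0)"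
    using assms by (simp add: f_def)
  then show ?thesis
    by (rule subst) (rule *)
qed

text \<open>The integrand is invariant under \<theta> -> 2 pi - \<theta>, so the half circle carries
  half of the preceding integral.\<close>

lemma spectral_integral_Dpol:
  assumes "n \<ge> 1"
  shows "integral {0..pi} (\<lambda>\<theta>. (sin \<theta>)\<^sup>2 * Dpol q n \<theta> * spectral_density q \<theta>) = (if n = 1 then pi / 2 * qgam q 1 else 0)"
proof -
  define h where "h \<theta> = (sin \<theta>)\<^sup>2 * Dpol q n \<theta> * spectral_density q \<theta>" for \<theta>
  have cont: "continuous_on A h" for A
    unfolding h_def by (intro continuous_intros)
  have full: "(h has_integral (if n = 1 then pi * qgam q 1 else 0)) {0..2 * pi}"
    using jost_solution_full_circle[OF assms] unfolding Im_jost_solution h_def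
    by (simp add: power2_eq_square mult_ac)
  have refl: "h (2 * pi - \<theta>) = h \<theta>" for \<theta>
  proof -
    have "cis (2 * pi - \<theta>) = cnj (cis \<theta>)"
      by (simp add: complex_eq_iff cos_diff sin_diff)
    then have "(cis (2 * pi - \<theta>))\<^sup>2 = cnj ((cis \<theta>)\<^sup>2)"
      by (simp only: complex_cnj_power)
    then have "spectral_density q (2 * pi - \<theta>) = (norm (jost_prod q (cnj ((cis \<theta>)\<^sup>2))))\<^sup>2"
      unfolding spectral_density_def by (rule arg_cong)
    also have "\<dots> = spectral_density q \<theta>"
      unfolding spectral_density_def by (subst jost_prod_cnj) (simp_all add: norm_power)
    finally have "spectral_density q (2 * pi - \<theta>) = spectral_density q \<theta>" .
    moreover have "Dpol q n (2 * pi - \<theta>) = Dpol q n \<theta>"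
    proof -
      have "cos ((2 * real k - real n + 1) * (2 * pi - \<theta>)) = cos ((2 * real k - real n + 1) * \<theta>)" for k
      proof -
        define i where "i = 2 * int k - int n + 1"
        have "2 * real k - real n + 1 = real_of_int i"
          by (simp add: i_def)
        moreover have "cos (real_of_int i * (2 * pi - \<theta>)) = cos (real_of_int i * \<theta>)"
          using cos_int_2pin[of i] sin_int_2pin[of i] by (simp add: right_diff_distrib cos_diff mult.commute)
        ultimately show ?thesis by simp
      qed
      then show ?thesis
        by (simp add: Dpol_def)
    qed
    ultimately show ?thesis
      by (simp add: h_def sin_diff)
  qed
  have "((\<lambda>x. - 1 *\<^sub>R h (2 * pi - x)) has_integral
      (integral {2 * pi - 0..2 * pi - pi} h - integral {2 * pi - pi..2 * pi - 0} h)) {0..pi}"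
    by (rule has_integral_substitution_general[of "{}" 0 pi "\<lambda>x. 2 * pi - x" pi "2 * pi"])
       (auto intro!: derivative_eq_intros continuous_intros cont)
  then have "((\<lambda>x. - h x) has_integral (- integral {pi..2 * pi} h)) {0..pi}"
    by (simp add: refl)
  from has_integral_neg[OF this] have "integral {0..pi} h = integral {pi..2 * pi} h"
    by (simp add: integral_unique)
  moreover have "integral {0..pi} h + integral {pi..2 * pi} h = integral {0..2 * pi} h"
    by (intro Henstock_Kurzweil_Integration.integral_combine integrable_continuous_interval cont) auto
  moreover have "integral {0..2 * pi} h = (if n = 1 then pi * qgam q 1 else 0)"
    by (rule integral_unique[OF full])
  ultimately show ?thesis
    unfolding h_def by (auto split: if_splits)
qed

text \<open>Multiplication by cos \<theta> may be moved onto either polynomial. Equating the two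
  results gives a recurrence for the matrix of integrals, which its columns k = 0 and k = 1
  determine; the latter is the preceding lemma.\<close>

lemma Dpol_orthogonal:
  "integral {0..pi} (\<lambda>\<theta>. (sin \<theta>)\<^sup>2 * (Dpol q n \<theta> * Dpol q k \<theta>) * spectral_density q \<theta>) =
    (if n = k then pi / 2 * qgam q n else 0)"
proof -
  define A where "A n k = integral {0..pi} (\<lambda>\<theta>. (sin \<theta>)\<^sup>2 * (Dpol q n \<theta> * Dpol q k \<theta>) * spectral_density q \<theta>)" for n k
  have int: "(\<lambda>\<theta>. (sin \<theta>)\<^sup>2 * (Dpol q n \<theta> * Dpol q k \<theta>) * spectral_density q \<theta>) integrable_on {0..pi}" for n k
    by (intro integrable_continuous_interval continuous_intros)
  have shift: "integral {0..pi} (\<lambda>\<theta>. (sin \<theta>)\<^sup>2 * (cos \<theta> * Dpol q n \<theta> * Dpol q k \<theta>) * spectral_density q \<theta>) =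
      qgam q n / 2 * (A (n - 1) k + A (n + 1) k)" for n k
  proof -
    have add: "A (n - 1) k + A (n + 1) k = integral {0..pi} (\<lambda>\<theta>.
        (sin \<theta>)\<^sup>2 * (Dpol q (n - 1) \<theta> * Dpol q k \<theta>) * spectral_density q \<theta> +
        (sin \<theta>)\<^sup>2 * (Dpol q (n + 1) \<theta> * Dpol q k \<theta>) * spectral_density q \<theta>)"
      unfolding A_def by (rule Henstock_Kurzweil_Integration.integral_add[OF int int, symmetric])
    have mult: "(sin \<theta>)\<^sup>2 * (cos \<theta> * Dpol q n \<theta> * Dpol q k \<theta>) * spectral_density q \<theta> = qgam q n / 2 *
        ((sin \<theta>)\<^sup>2 * (Dpol q (n - 1) \<theta> * Dpol q k \<theta>) * spectral_density q \<theta> +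
         (sin \<theta>)\<^sup>2 * (Dpol q (n + 1) \<theta> * Dpol q k \<theta>) * spectral_density q \<theta>)" for \<theta>
      unfolding cos_mult_Dpol by (simp add: algebra_simps)
    show ?thesis
      unfolding mult integral_mult_right add ..
  qed
  have sym: "A n k = A k n" for n k
    by (simp add: A_def mult.commute)
  have cross: "qgam q n * (A (n - 1) k + A (n + 1) k) = qgam q k * (A n (k - 1) + A n (k + 1))" for n k
  proof -
    have "qgam q n / 2 * (A (n - 1) k + A (n + 1) k) = qgam q k / 2 * (A (k - 1) n + A (k + 1) n)"
      unfolding shift[symmetric] by (simp only: mult_ac)
    then show ?thesis
      by (simp add: sym[of _ n])
  qed
  have "(\<forall>n. A n k = (if n = k then pi / 2 * qgam q n else 0)) \<and>
      (\<forall>n. A n (Suc k) = (if n = Suc k then pi / 2 * qgam q n else 0))"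
  proof (induction k)
    case 0
    have "A n (Suc 0) = (if n = Suc 0 then pi / 2 * qgam q n else 0)" for n
    proof (cases "n = 0")
      case False
      then show ?thesis
        using spectral_integral_Dpol[of n] by (auto simp: A_def Dpol_1)
    qed (simp add: A_def Dpol_0)
    then show ?case
      by (auto simp: A_def Dpol_0 qgam_0)
  next
    case (Suc k)
    have "A n (Suc (Suc k)) = (if n = Suc (Suc k) then pi / 2 * qgam q n else 0)" for n
    proof (cases n)
      case (Suc m)
      \<comment> \<open>The relation \<open>cross\<close> is solved for the new column;
        \<open>qgam q (Suc k)\<close> is nonzero and can be cancelled.\<close>
      have "qgam q (Suc k) * A n (Suc (Suc k)) = qgam q n * (A m (Suc k) + A (Suc n) (Suc k)) - qgam q (Suc k) * A n k"
        using cross[of n "Suc k"] by (simp add: Suc algebra_simps)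
      also have "\<dots> = qgam q (Suc k) * (if n = Suc (Suc k) then pi / 2 * qgam q n else 0)"
        using Suc.IH by (auto simp: Suc)
      finally show ?thesis
        using qgam_Suc_pos[of k] by auto
    qed (simp add: A_def Dpol_0)
    with Suc show ?case by blast
  qed
  then show ?thesis
    by (simp add: A_def)
qed

end

section \<open>The spectral representation of the flow\<close>

lemma gam_eq_qgam: "gam \<kappa> n = qgam (qpar \<kappa>) n"
proof -
  have "exp (- 2 * (\<kappa> * real n)) = qpar \<kappa> ^ n"
    unfolding qpar_def exp_of_nat_mult[symmetric] by (simp add: mult_ac)
  then show ?thesis
    by (simp add: gam_def qgam_def tanh_real_altdef)
qed

lemma nome_qpar: "\<kappa> > 0 \<Longrightarrow> nome (qpar \<kappa>)"
  by unfold_locales (simp_all add: qpar_def)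

section \<open>Infinite q-Pochhammer products and the weight\<close>

lemma convergent_prod_qpoch:
  fixes a q :: "'a :: {real_normed_field, banach}"
  assumes "norm q < 1"
  shows "convergent_prod (\<lambda>j. 1 - a * q ^ j)"
proof -
  have "summable (\<lambda>j. norm a * norm q ^ j)"
    using assms by (intro summable_mult summable_geometric) simp
  then have "summable (\<lambda>j. norm (1 - a * q ^ j - 1))"
    by (simp add: norm_mult norm_power)
  then show ?thesis
    by (intro abs_convergent_prod_imp_convergent_prod) (simp add: abs_convergent_prod_conv_summable)
qed

lemma qpoch_LIMSEQ:
  fixes a q :: "'a :: {real_normed_field, banach}"
  assumes "norm q < 1"
  shows "qpoch a q \<longlonglongrightarrow> qpoch_inf a q"
  using convergent_prod_LIMSEQ[OF convergent_prod_qpoch[OF assms, of a]]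
  unfolding qpoch_def qpoch_inf_def by (simp add: LIMSEQ_lessThan_iff_atMost)

lemma qpoch_inf_ne_0:
  fixes a q :: "'a :: {real_normed_field, banach}"
  assumes "norm q < 1" "norm a < 1"
  shows "qpoch_inf a q \<noteq> 0"
  unfolding qpoch_inf_def
proof (intro prodinf_nonzero convergent_prod_qpoch assms)
  fix j
  have "norm (a * q ^ j) \<le> norm a * 1"
    unfolding norm_mult norm_power using assms by (intro mult_left_mono power_le_one) auto
  then have "norm (a * q ^ j) < 1"
    using assms by simp
  then show "1 - a * q ^ j \<noteq> 0"
    by (metis eq_iff_diff_eq_0 less_irrefl norm_one)
qed

text \<open>The weight is stated with complex products and the leading asymptotic coefficient with
  real ones; this identifies them.\<close>

lemma qpoch_inf_of_real:
  fixes a q :: real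
  assumes "\<bar>q\<bar> < 1"
  shows "qpoch_inf (complex_of_real a) (of_real q) = of_real (qpoch_inf a q)"
proof (rule LIMSEQ_unique)
  show "qpoch (complex_of_real a) (of_real q) \<longlonglongrightarrow> qpoch_inf (of_real a) (of_real q)"
    using assms by (intro qpoch_LIMSEQ) simp
  have "(\<lambda>n. complex_of_real (qpoch a q n)) \<longlonglongrightarrow> of_real (qpoch_inf a q)"
    using assms by (intro tendsto_of_real qpoch_LIMSEQ) simp
  then show "qpoch (complex_of_real a) (of_real q) \<longlonglongrightarrow> of_real (qpoch_inf a q)"
    by (simp add: qpoch_def[abs_def])
qed

context nome
begin

lemma jost_prod_eq_qpoch:
  assumes y: "norm y \<le> 1"
  shows "jost_prod q y = (qpoch_inf (of_real q) (of_real q) * qpoch_inf (of_real q * y) (of_real q)) /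
    (qpoch_inf (- of_real q) (of_real q) * qpoch_inf (- of_real q * y) (of_real q))"
proof (rule LIMSEQ_unique[OF jost_prod_LIMSEQ[OF y]])
  let ?Q = "complex_of_real q"
  have Q: "norm ?Q < 1"
    using q_pos q_less_1 by simp
  have Qy: "norm (- ?Q * y) < 1"
    using y q_pos q_less_1 by (simp add: norm_mult) (meson le_less_trans less_imp_le mult_left_le)
  have "(\<lambda>N. (qpoch ?Q ?Q N * qpoch (?Q * y) ?Q N) / (qpoch (- ?Q) ?Q N * qpoch (- ?Q * y) ?Q N)) \<longlonglongrightarrow>
      (qpoch_inf ?Q ?Q * qpoch_inf (?Q * y) ?Q) / (qpoch_inf (- ?Q) ?Q * qpoch_inf (- ?Q * y) ?Q)"
    using qpoch_inf_ne_0[OF Q, of "- ?Q"] qpoch_inf_ne_0[OF Q Qy] Q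
    by (intro tendsto_intros qpoch_LIMSEQ Q) auto
  moreover have "(\<Prod>i<N. jost_factor q i y) =
      (qpoch ?Q ?Q N * qpoch (?Q * y) ?Q N) / (qpoch (- ?Q) ?Q N * qpoch (- ?Q * y) ?Q N)" for N
    unfolding jost_factor_def qpoch_def prod_dividef prod.distrib
    by (simp add: mult_ac)
  ultimately show "(\<lambda>N. \<Prod>i<N. jost_factor q i y) \<longlonglongrightarrow>
      (qpoch_inf ?Q ?Q * qpoch_inf (?Q * y) ?Q) / (qpoch_inf (- ?Q) ?Q * qpoch_inf (- ?Q * y) ?Q)"
    by simp
qed

lemma spectral_density_eq_qpoch:
  "spectral_density q \<theta> = (cmod ((qpoch_inf (of_real q) (of_real q) *
       qpoch_inf (of_real q * exp (2 * \<i> * of_real \<theta>)) (of_real q)) /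
     (qpoch_inf (- of_real q) (of_real q) * qpoch_inf (- of_real q * exp (2 * \<i> * of_real \<theta>)) (of_real q))))\<^sup>2"
proof -
  have "exp (2 * \<i> * of_real \<theta>) = (cis \<theta>)\<^sup>2"
    by (simp add: cis_conv_exp mult.assoc exp_double)
  then show ?thesis
    unfolding spectral_density_def by (subst jost_prod_eq_qpoch) (simp_all add: norm_power)
qed

lemma spectral_density_0:
  "spectral_density q 0 = qpoch_inf q q ^ 4 / qpoch_inf (- q) q ^ 4"
proof -
  have q: "\<bar>q\<bar> < 1"
    using q_pos q_less_1 by simp
  have "jost_prod q 1 = of_real ((qpoch_inf q q)\<^sup>2 / (qpoch_inf (- q) q)\<^sup>2)"
    using qpoch_inf_of_real[OF q, of q] qpoch_inf_of_real[OF q, of "- q"]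
    by (subst jost_prod_eq_qpoch) (simp_all add: power2_eq_square)
  then show ?thesis
    unfolding spectral_density_def
    by (simp add: norm_divide norm_power power_divide flip: power_mult)
qed

end

text \<open>The exponential series converges uniformly on the compact interval because H is bounded
  there, so it may be integrated term by term.\<close>

lemma exp_cos_moment_sums:
  assumes H: "continuous_on {0..pi} H"
  shows "(\<lambda>j. integral {0..pi} (\<lambda>\<theta>. cos \<theta> ^ j * H \<theta>) / fact j * t ^ j) sums
    integral {0..pi} (\<lambda>\<theta>. exp (t * cos \<theta>) * H \<theta>)"
proof -
  let ?f = "\<lambda>j \<theta>. t ^ j / fact j * (cos \<theta> ^ j * H \<theta>)"
  let ?s = "\<lambda>N \<theta>. \<Sum>j<N. ?f j \<theta>"
  have "\<exists>B. \<forall>\<theta>\<in>{0..pi}. \<bar>H \<theta>\<bar> \<le> B"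
    using compact_imp_bounded[OF compact_continuous_image[OF H compact_Icc]]
    unfolding bounded_iff by auto
  then obtain B where B: "\<And>\<theta>. \<theta> \<in> {0..pi} \<Longrightarrow> \<bar>H \<theta>\<bar> \<le> B"
    by blast
  have lim: "uniform_limit {0..pi} ?s (\<lambda>\<theta>. \<Sum>j. ?f j \<theta>) sequentially"
  proof (rule Weierstrass_m_test)
    show "summable (\<lambda>j. inverse (fact j) * \<bar>t\<bar> ^ j * B)"
      by (intro summable_mult2 summable_exp)
    show "norm (?f j \<theta>) \<le> inverse (fact j) * \<bar>t\<bar> ^ j * B" if "\<theta> \<in> {0..pi}" for j \<theta>
    proof -
      have "norm (?f j \<theta>) = inverse (fact j) * \<bar>t\<bar> ^ j * (\<bar>cos \<theta>\<bar> ^ j * \<bar>H \<theta>\<bar>)"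
        by (simp add: abs_mult power_abs divide_inverse)
      also have "\<dots> \<le> inverse (fact j) * \<bar>t\<bar> ^ j * (1 * B)"
        using B[OF that] by (intro mult_left_mono mult_mono power_le_one) auto
      finally show ?thesis by simp
    qed
  qed
  have sum: "(\<Sum>j. ?f j \<theta>) = exp (t * cos \<theta>) * H \<theta>" for \<theta>
  proof -
    have "(\<lambda>j. (t * cos \<theta>) ^ j /\<^sub>R fact j * H \<theta>) sums (exp (t * cos \<theta>) * H \<theta>)"
      by (intro sums_mult2 exp_converges)
    then show ?thesis
      by (intro sums_unique[symmetric]) (simp add: power_mult_distrib divide_inverse mult_ac)
  qed
  have cont: "continuous_on {0..pi} (?f j)" for j
    by (intro continuous_intros H)
  have cs: "continuous_on {0..pi} (?s N)" for N
    by (intro continuous_intros H)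
  obtain I J where IJ: "\<And>N. (?s N has_integral I N) {0..pi}"
    "((\<lambda>\<theta>. exp (t * cos \<theta>) * H \<theta>) has_integral J) {0..pi}" "I \<longlonglongrightarrow> J"
    using uniform_limit_integral[OF lim[unfolded sum] cs sequentially_bot] by blast
  have "I N = (\<Sum>j<N. integral {0..pi} (\<lambda>\<theta>. cos \<theta> ^ j * H \<theta>) / fact j * t ^ j)" for N
  proof -
    have "I N = integral {0..pi} (?s N)"
      using IJ(1)[of N] by (simp add: integral_unique)
    also have "\<dots> = (\<Sum>j<N. integral {0..pi} (?f j))"
      by (intro integral_sum integrable_continuous_interval cont) auto
    also have "\<dots> = (\<Sum>j<N. t ^ j / fact j * integral {0..pi} (\<lambda>\<theta>. cos \<theta> ^ j * H \<theta>))"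
      by (simp only: integral_mult_right)
    finally show ?thesis
      by (simp add: mult.commute)
  qed
  then have I: "I = (\<lambda>N. \<Sum>j<N. integral {0..pi} (\<lambda>\<theta>. cos \<theta> ^ j * H \<theta>) / fact j * t ^ j)"
    by (rule ext)
  show ?thesis
    unfolding sums_def integral_unique[OF IJ(2)] I[symmetric] by (rule IJ(3))
qed

lemma Ppol_eq_Dpol: "Ppol \<kappa> n \<theta> = sqrt (gam \<kappa> 1 / gam \<kappa> n) * Dpol (qpar \<kappa>) n \<theta>"
  by (simp add: Ppol_def Dpol_def ratio_coeff_def)

lemma gam_pos:
  assumes "\<kappa> > 0" "n \<ge> 1"
  shows "gam \<kappa> n > 0"
  using assms by (simp add: gam_def)

text \<open>The three square roots combine to \<open>gam \<kappa> 1 / gam \<kappa> k\<close>. At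
  \<open>n = 0\<close> both sides are 0, since \<open>Dpol\<close> is an empty sum.\<close>

lemma qk_eq_Dpol:
  assumes \<kappa>: "\<kappa> > 0" and k: "k \<ge> 1"
  shows "qk \<kappa> k n t = 2 / (pi * gam \<kappa> k) * integral {0..pi} (\<lambda>\<theta>. exp (- t * (1 - cos \<theta>)) *
    ((sin \<theta>)\<^sup>2 * (Dpol (qpar \<kappa>) n \<theta> * Dpol (qpar \<kappa>) k \<theta>) * spectral_density (qpar \<kappa>) \<theta>))"
proof (cases "n = 0")
  case True
  then show ?thesis
    by (simp add: qk_def Dpol_def)
next
  case False
  interpret nome "qpar \<kappa>"
    by (rule nome_qpar[OF \<kappa>])
  let ?c = "sqrt (gam \<kappa> 1 / gam \<kappa> n) * sqrt (gam \<kappa> 1 / gam \<kappa> k)"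
  let ?J = "integral {0..pi} (\<lambda>\<theta>. exp (- t * (1 - cos \<theta>)) *
    ((sin \<theta>)\<^sup>2 * (Dpol (qpar \<kappa>) n \<theta> * Dpol (qpar \<kappa>) k \<theta>) * spectral_density (qpar \<kappa>) \<theta>))"
  have pos: "gam \<kappa> 1 > 0" "gam \<kappa> n > 0" "gam \<kappa> k > 0"
    using gam_pos[OF \<kappa>] k False by auto
  have "sqrt (gam \<kappa> n / gam \<kappa> k) * ?c = sqrt ((gam \<kappa> 1 / gam \<kappa> k)\<^sup>2)"
    unfolding real_sqrt_mult[symmetric] using pos by (simp add: power2_eq_square field_simps)
  also have "\<dots> = gam \<kappa> 1 / gam \<kappa> k"
    using pos by simp
  finally have c: "sqrt (gam \<kappa> n / gam \<kappa> k) * ?c = gam \<kappa> 1 / gam \<kappa> k" .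
  have eq: "exp (- t * (1 - cos \<theta>)) * (sin \<theta>)\<^sup>2 * Ppol \<kappa> n \<theta> * Ppol \<kappa> k \<theta> * spectral_density (qpar \<kappa>) \<theta> =
      ?c * (exp (- t * (1 - cos \<theta>)) *
        ((sin \<theta>)\<^sup>2 * (Dpol (qpar \<kappa>) n \<theta> * Dpol (qpar \<kappa>) k \<theta>) * spectral_density (qpar \<kappa>) \<theta>))" for \<theta>
    unfolding Ppol_eq_Dpol by (simp only: mult_ac)
  have "qk \<kappa> k n t = 2 / (pi * gam \<kappa> 1) * sqrt (gam \<kappa> n / gam \<kappa> k) * (?c * ?J)"
    unfolding qk_def spectral_density_eq_qpoch[symmetric] eq integral_mult_right ..
  also have "\<dots> = 2 / (pi * gam \<kappa> 1) * (sqrt (gam \<kappa> n / gam \<kappa> k) * ?c) * ?J"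
    by (simp only: mult.assoc)
  finally show ?thesis
    unfolding c using pos by simp
qed

text \<open>Under the integral, multiplication by cos \<theta> acts on the index n as the coupling
  operator; orthogonality provides the unit vector at k to start from.\<close>

lemma moment_eq_glauber_iter:
  assumes \<kappa>: "\<kappa> > 0" and k: "k \<ge> 1"
  shows "2 / (pi * gam \<kappa> k) * integral {0..pi} (\<lambda>\<theta>. cos \<theta> ^ j *
      ((sin \<theta>)\<^sup>2 * (Dpol (qpar \<kappa>) n \<theta> * Dpol (qpar \<kappa>) k \<theta>) * spectral_density (qpar \<kappa>) \<theta>)) =
    glauber_iter \<kappa> (\<lambda>n. if n = k then 1 else 0) j n"
proof -
  interpret nome "qpar \<kappa>"
    by (rule nome_qpar[OF \<kappa>])
  let ?g = "\<lambda>j n \<theta>. cos \<theta> ^ j *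
    ((sin \<theta>)\<^sup>2 * (Dpol (qpar \<kappa>) n \<theta> * Dpol (qpar \<kappa>) k \<theta>) * spectral_density (qpar \<kappa>) \<theta>)"
  have int: "?g j n integrable_on {0..pi}" for j n
    by (intro integrable_continuous_interval continuous_intros)
  show ?thesis
  proof (induction j arbitrary: n)
    case 0
    then show ?case
      using Dpol_orthogonal[of n k] gam_pos[OF \<kappa> k] k
      by (simp add: gam_eq_qgam[symmetric])
  next
    case (Suc j)
    have "?g (Suc j) n \<theta> = gam \<kappa> n / 2 * (?g j (n - 1) \<theta> + ?g j (n + 1) \<theta>)" for \<theta>
    proof -
      have "?g (Suc j) n \<theta> = cos \<theta> ^ j *
          ((sin \<theta>)\<^sup>2 * ((cos \<theta> * Dpol (qpar \<kappa>) n \<theta>) * Dpol (qpar \<kappa>) k \<theta>) * spectral_density (qpar \<kappa>) \<theta>)"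
        by (simp add: mult_ac)
      then show ?thesis
        unfolding cos_mult_Dpol gam_eq_qgam by (simp add: algebra_simps)
    qed
    then have "integral {0..pi} (?g (Suc j) n) = gam \<kappa> n / 2 *
        (integral {0..pi} (?g j (n - 1)) + integral {0..pi} (?g j (n + 1)))"
      by (simp only: integral_mult_right Henstock_Kurzweil_Integration.integral_add[OF int int])
    then show ?case
      unfolding glauber_iter.simps Suc[symmetric] by (simp only: mult_ac distrib_left)
  qed
qed

lemma qk_eq_glauber_flow:
  assumes \<kappa>: "\<kappa> > 0" and k: "k \<ge> 1"
  shows "qk \<kappa> k n t = glauber_flow \<kappa> (\<lambda>n. if n = k then 1 else 0) n t"
proof -
  interpret nome "qpar \<kappa>"
    by (rule nome_qpar[OF \<kappa>])
  define H where "H \<theta> = (sin \<theta>)\<^sup>2 * (Dpol (qpar \<kappa>) n \<theta> * Dpol (qpar \<kappa>) k \<theta>) * spectral_density (qpar \<kappa>) \<theta>" for \<theta>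
  let ?C = "2 / (pi * gam \<kappa> k)"
  have "continuous_on {0..pi} H"
    unfolding H_def by (intro continuous_intros)
  from sums_mult[OF exp_cos_moment_sums[OF this, of t], of ?C]
  have "(\<lambda>j. glauber_iter \<kappa> (\<lambda>n. if n = k then 1 else 0) j n / fact j * t ^ j) sums
      (?C * integral {0..pi} (\<lambda>\<theta>. exp (t * cos \<theta>) * H \<theta>))"
    unfolding H_def moment_eq_glauber_iter[OF \<kappa> k, symmetric] by (simp add: mult_ac)
  then have "glauber_flow \<kappa> (\<lambda>n. if n = k then 1 else 0) n t =
      exp (- t) * (?C * integral {0..pi} (\<lambda>\<theta>. exp (t * cos \<theta>) * H \<theta>))"
    by (simp only: glauber_flow_def sums_iff)
  also have "\<dots> = ?C * integral {0..pi} (\<lambda>\<theta>. exp (- t) * (exp (t * cos \<theta>) * H \<theta>))"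
    unfolding integral_mult_right by (simp only: mult_ac)
  also have "(\<lambda>\<theta>. exp (- t) * (exp (t * cos \<theta>) * H \<theta>)) = (\<lambda>\<theta>. exp (- t * (1 - cos \<theta>)) * H \<theta>)"
  proof
    fix \<theta>
    have "exp (- t) * exp (t * cos \<theta>) = exp (- t * (1 - cos \<theta>))"
      unfolding exp_add[symmetric] by (simp add: algebra_simps)
    then show "exp (- t) * (exp (t * cos \<theta>) * H \<theta>) = exp (- t * (1 - cos \<theta>)) * H \<theta>"
      by (simp only: mult.assoc[symmetric])
  qed
  finally show ?thesis
    unfolding qk_eq_Dpol[OF \<kappa> k] H_def by simp
qed

section \<open>Laplace asymptotics\<close>

text \<open>Equals Gamma(k + 1/2) / 2, the moment of order 2 k of exp (-x^2) over the
  half-line.\<close>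

definition gauss_moment :: "nat \<Rightarrow> real" where
  "gauss_moment k = (sqrt pi / 2) * (fact (2 * k) / (2 ^ (2 * k) * fact k))"

lemma gauss_moment_has_integral:
  "((\<lambda>x::real. if x \<in> {0..} then exp (- x\<^sup>2) * x ^ (2 * k) else 0) has_integral gauss_moment k) UNIV"
proof -
  have "integrable lborel (\<lambda>x::real. indicator {0..} x *\<^sub>R (exp (- x\<^sup>2) * x ^ (2 * k)))"
    "integral\<^sup>L lborel (\<lambda>x::real. indicator {0..} x *\<^sub>R (exp (- x\<^sup>2) * x ^ (2 * k))) = gauss_moment k"
    using gaussian_moment_even_pos[of k] by (auto simp: has_bochner_integral_iff gauss_moment_def)
  with has_integral_integral_lborel[of "\<lambda>x::real. indicator {0..} x *\<^sub>R (exp (- x\<^sup>2) * x ^ (2 * k))"]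
  have "((\<lambda>x::real. indicator {0..} x *\<^sub>R (exp (- x\<^sup>2) * x ^ (2 * k))) has_integral gauss_moment k) UNIV"
    by simp
  also have "(\<lambda>x::real. indicator {0..} x *\<^sub>R (exp (- x\<^sup>2) * x ^ (2 * k))) =
      (\<lambda>x. if x \<in> {0..} then exp (- x\<^sup>2) * x ^ (2 * k) else 0)"
    by (rule ext) (simp add: indicator_def)
  finally show ?thesis .
qed

lemma gauss_moment_partial_has_integral:
  "((\<lambda>x::real. if x \<in> {0..b} then exp (- x\<^sup>2) * x ^ (2 * k) else 0) has_integral
     integral {0..b} (\<lambda>x. exp (- x\<^sup>2) * x ^ (2 * k))) UNIV"
  unfolding has_integral_restrict_UNIV
  by (intro integrable_integral integrable_continuous_interval continuous_intros)

lemma gauss_moment_partial_le: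
  "integral {0..b} (\<lambda>x. exp (- x\<^sup>2) * x ^ (2 * k)) \<le> gauss_moment k"
  by (rule has_integral_le[OF gauss_moment_partial_has_integral gauss_moment_has_integral]) auto

text \<open>Beyond b one has 1 \<le> x^2 / b^2, so the tail of the second moment is at most the
  fourth moment divided by b^2.\<close>

lemma gauss_moment_tail:
  assumes "b > 0"
  shows "\<bar>integral {0..b} (\<lambda>x. exp (- x\<^sup>2) * x ^ (2 * 1)) - gauss_moment 1\<bar> \<le> gauss_moment 2 / b\<^sup>2"
proof -
  let ?f = "\<lambda>k x::real. exp (- x\<^sup>2) * x ^ (2 * k)"
  have "((\<lambda>x. b\<^sup>2 * ((if x \<in> {0..} then ?f 1 x else 0) - (if x \<in> {0..b} then ?f 1 x else 0))) has_integral
      b\<^sup>2 * (gauss_moment 1 - integral {0..b} (?f 1))) UNIV"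
    by (intro has_integral_mult_right has_integral_diff gauss_moment_has_integral gauss_moment_partial_has_integral)
  then have "b\<^sup>2 * (gauss_moment 1 - integral {0..b} (?f 1)) \<le> gauss_moment 2"
  proof (rule has_integral_le[OF _ gauss_moment_has_integral[of 2]])
    fix x :: real
    show "b\<^sup>2 * ((if x \<in> {0..} then ?f 1 x else 0) - (if x \<in> {0..b} then ?f 1 x else 0)) \<le>
        (if x \<in> {0..} then ?f 2 x else 0)"
    proof (cases "x > b")
      case True
      then have "b\<^sup>2 \<le> x\<^sup>2"
        using assms by (intro power_mono) auto
      then have "b\<^sup>2 * (exp (- x\<^sup>2) * x\<^sup>2) \<le> x\<^sup>2 * (exp (- x\<^sup>2) * x\<^sup>2)"
        by (intro mult_right_mono) auto
      moreover have "x\<^sup>2 * (exp (- x\<^sup>2) * x\<^sup>2) = ?f 2 x"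
        by (simp add: power2_eq_square power4_eq_xxxx)
      ultimately show ?thesis
        using True assms by simp
    qed auto
  qed
  then have "gauss_moment 1 - integral {0..b} (?f 1) \<le> gauss_moment 2 / b\<^sup>2"
    using assms by (simp add: field_simps)
  then show ?thesis
    using gauss_moment_partial_le[of b 1] by linarith
qed

lemma one_minus_cos: "1 - cos \<theta> = 2 * (sin (\<theta> / 2))\<^sup>2" for \<theta> :: real
  using cos_double_sin[of "\<theta> / 2"] by simp

text \<open>With x = sqrt (2 t) sin (\<theta> / 2) the exponent t (1 - cos \<theta>) is x^2, and dx
  = sqrt (t / 2) cos (\<theta> / 2) d\<theta>.\<close>

lemma laplace_substitution:
  assumes t: "t > 0"
  shows "((\<lambda>\<theta>. exp (- t * (1 - cos \<theta>)) * (sin (\<theta> / 2) ^ (2 * k) * cos (\<theta> / 2))) has_integral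
    integral {0..sqrt (2 * t)} (\<lambda>x. exp (- x\<^sup>2) * x ^ (2 * k)) / ((2 * t) ^ k * sqrt (t / 2))) {0..pi}"
proof -
  let ?g = "\<lambda>\<theta>. sqrt (2 * t) * sin (\<theta> / 2)" and ?g' = "\<lambda>\<theta>. sqrt (t / 2) * cos (\<theta> / 2)"
  let ?f = "\<lambda>x::real. exp (- x\<^sup>2) * x ^ (2 * k)"
  have half: "sqrt (2 * t) * (1 / 2) = sqrt (t / 2)"
  proof -
    have "sqrt (2 * t) * (1 / 2) = sqrt (2 * t) * sqrt (1 / 4)"
      by (simp add: real_sqrt_divide)
    also have "\<dots> = sqrt (t / 2)"
      unfolding real_sqrt_mult[symmetric] by simp
    finally show ?thesis .
  qed
  have "((\<lambda>\<theta>. ?g' \<theta> *\<^sub>R ?f (?g \<theta>)) has_integral (integral {?g 0..?g pi} ?f)) {0..pi}"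
  proof (rule has_integral_substitution[of 0 pi ?g "- sqrt (2 * t)" "sqrt (2 * t)"])
    show "?g ` {0..pi} \<subseteq> {- sqrt (2 * t)..sqrt (2 * t)}"
    proof safe
      fix \<theta> :: real
      have "\<bar>?g \<theta>\<bar> \<le> sqrt (2 * t) * 1"
        unfolding abs_mult using t by (intro mult_mono) auto
      then show "?g \<theta> \<in> {- sqrt (2 * t)..sqrt (2 * t)}"
        by (simp add: abs_le_iff)
    qed
    show "(?g has_real_derivative ?g' \<theta>) (at \<theta> within {0..pi})" for \<theta>
      unfolding half[symmetric] by (auto intro!: derivative_eq_intros)
  qed (use t in \<open>auto intro!: continuous_intros\<close>)
  then have *: "((\<lambda>\<theta>. ?g' \<theta> * ?f (?g \<theta>)) has_integral (integral {0..sqrt (2 * t)} ?f)) {0..pi}"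
    by simp
  have c: "(2 * t) ^ k * sqrt (t / 2) \<noteq> 0"
    using t by simp
  have "?g' \<theta> * ?f (?g \<theta>) = ((2 * t) ^ k * sqrt (t / 2)) *
      (exp (- t * (1 - cos \<theta>)) * (sin (\<theta> / 2) ^ (2 * k) * cos (\<theta> / 2)))" for \<theta>
  proof -
    have "(?g \<theta>)\<^sup>2 = t * (1 - cos \<theta>)"
      using t by (simp add: power_mult_distrib one_minus_cos)
    moreover have "(?g \<theta>) ^ (2 * k) = (2 * t) ^ k * sin (\<theta> / 2) ^ (2 * k)"
      using t by (simp add: power_mult power_mult_distrib)
    ultimately show ?thesis
      by (simp only: mult_minus_left mult_ac)
  qed
  with * have "((\<lambda>\<theta>. ((2 * t) ^ k * sqrt (t / 2)) *
      (exp (- t * (1 - cos \<theta>)) * (sin (\<theta> / 2) ^ (2 * k) * cos (\<theta> / 2)))) has_integral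
      (integral {0..sqrt (2 * t)} ?f)) {0..pi}"
    by simp
  from has_integral_divide[OF this, of "(2 * t) ^ k * sqrt (t / 2)"] show ?thesis
    using c by simp
qed

text \<open>The half-angle variable makes the phase exactly quadratic, and
  \<open>sin\<^sup>2 \<theta>\<close> supplies the Jacobian factor \<open>cos (\<theta> / 2)\<close>.\<close>

lemma laplace_asymptotics:
  fixes F :: "real \<Rightarrow> real"
  assumes F: "continuous_on {0..pi} F"
    and C: "\<And>\<theta>. \<theta> \<in> {0..pi} \<Longrightarrow> \<bar>cos (\<theta> / 2) * F \<theta> - F 0\<bar> \<le> C * (sin (\<theta> / 2))\<^sup>2"
  shows "(\<lambda>t. integral {0..pi} (\<lambda>\<theta>. exp (- t * (1 - cos \<theta>)) * ((sin \<theta>)\<^sup>2 * F \<theta>)) -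
      sqrt (pi / 2) * F 0 / t powr (3 / 2)) \<in> O(\<lambda>t. t powr (- 5 / 2))"
proof -
  define M where "M = gauss_moment 2"
  define E where "E t \<theta> = exp (- t * (1 - cos \<theta>))" for t \<theta> :: real
  define g where "g k t = integral {0..sqrt (2 * t)} (\<lambda>x::real. exp (- x\<^sup>2) * x ^ (2 * k))" for k t
  have bound: "\<bar>integral {0..pi} (\<lambda>\<theta>. E t \<theta> * ((sin \<theta>)\<^sup>2 * F \<theta>)) - sqrt (pi / 2) * F 0 / t powr (3 / 2)\<bar> \<le>
      (sqrt 2 * M * (C + \<bar>F 0\<bar>)) * t powr (- 5 / 2)" if t: "t > 0" for t
  proof -
    let ?s = "\<lambda>\<theta>::real. sin (\<theta> / 2)" and ?c = "\<lambda>\<theta>::real. cos (\<theta> / 2)"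
    have sub: "((\<lambda>\<theta>. E t \<theta> * (?s \<theta> ^ (2 * k) * ?c \<theta>)) has_integral
        g k t / ((2 * t) ^ k * sqrt (t / 2))) {0..pi}" for k
      unfolding E_def g_def by (rule laplace_substitution[OF t])
    have "((\<lambda>\<theta>. E t \<theta> * ((sin \<theta>)\<^sup>2 * F \<theta>)) has_integral
        integral {0..pi} (\<lambda>\<theta>. E t \<theta> * ((sin \<theta>)\<^sup>2 * F \<theta>))) {0..pi}"
      unfolding E_def by (intro integrable_integral integrable_continuous_interval continuous_intros F)
    from has_integral_diff[OF this has_integral_mult_right[OF sub[of 1], of "4 * F 0"]]
    have diff: "((\<lambda>\<theta>. E t \<theta> * ((sin \<theta>)\<^sup>2 * F \<theta>) - 4 * F 0 * (E t \<theta> * (?s \<theta> ^ (2 * 1) * ?c \<theta>))) has_integral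
        (integral {0..pi} (\<lambda>\<theta>. E t \<theta> * ((sin \<theta>)\<^sup>2 * F \<theta>)) - 4 * F 0 * (g 1 t / ((2 * t) ^ 1 * sqrt (t / 2))))) {0..pi}" .
    \<comment> \<open>Of the two factors cos (\<theta> / 2) in sin^2 \<theta>, one is kept as the
      Jacobian and the other joins F, which is why the hypothesis concerns cos (\<theta> / 2)
      F.\<close>
    have ptw: "\<bar>E t \<theta> * ((sin \<theta>)\<^sup>2 * F \<theta>) - 4 * F 0 * (E t \<theta> * (?s \<theta> ^ (2 * 1) * ?c \<theta>))\<bar> \<le>
        4 * C * (E t \<theta> * (?s \<theta> ^ (2 * 2) * ?c \<theta>))" if \<theta>: "\<theta> \<in> {0..pi}" for \<theta>
    proof -
      have "sin \<theta> = 2 * ?s \<theta> * ?c \<theta>"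
        using sin_double[of "\<theta> / 2"] by simp
      then have eq: "E t \<theta> * ((sin \<theta>)\<^sup>2 * F \<theta>) - 4 * F 0 * (E t \<theta> * (?s \<theta> ^ (2 * 1) * ?c \<theta>)) =
          4 * E t \<theta> * (?s \<theta>)\<^sup>2 * ?c \<theta> * (?c \<theta> * F \<theta> - F 0)"
        by (simp add: power2_eq_square algebra_simps)
      have c: "0 \<le> ?c \<theta>"
        using \<theta> by (intro cos_ge_zero) auto
      have "\<bar>4 * E t \<theta> * (?s \<theta>)\<^sup>2 * ?c \<theta> * (?c \<theta> * F \<theta> - F 0)\<bar> =
          4 * E t \<theta> * (?s \<theta>)\<^sup>2 * ?c \<theta> * \<bar>?c \<theta> * F \<theta> - F 0\<bar>"
        using c by (simp add: abs_mult E_def)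
      also have "\<dots> \<le> 4 * E t \<theta> * (?s \<theta>)\<^sup>2 * ?c \<theta> * (C * (?s \<theta>)\<^sup>2)"
        using c by (intro mult_left_mono C \<theta>) (auto simp: E_def)
      also have "\<dots> = 4 * C * (E t \<theta> * (?s \<theta> ^ (2 * 2) * ?c \<theta>))"
        by (simp add: power2_eq_square power4_eq_xxxx)
      finally show ?thesis
        unfolding eq .
    qed
    \<comment> \<open>At \<theta> = pi the factor sin^2 (\<theta> / 2) equals 1.\<close>
    have "0 \<le> C"
      using order_trans[OF abs_ge_zero C[of pi]] by simp
    have "\<bar>integral {0..pi} (\<lambda>\<theta>. E t \<theta> * ((sin \<theta>)\<^sup>2 * F \<theta>)) - 4 * F 0 * (g 1 t / ((2 * t) ^ 1 * sqrt (t / 2)))\<bar> \<le>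
        4 * C * (g 2 t / ((2 * t)\<^sup>2 * sqrt (t / 2)))"
      using has_integral_le[OF diff has_integral_mult_right[OF sub[of 2], of "4 * C"]]
        has_integral_le[OF has_integral_neg[OF diff] has_integral_mult_right[OF sub[of 2], of "4 * C"]] ptw
      by (auto simp: abs_le_iff)
    also have "\<dots> \<le> 4 * C * (M / ((2 * t)\<^sup>2 * sqrt (t / 2)))"
      using t \<open>0 \<le> C\<close> gauss_moment_partial_le[of "sqrt (2 * t)" 2]
      by (intro mult_left_mono divide_right_mono) (auto simp: g_def M_def)
    finally have 1: "\<bar>integral {0..pi} (\<lambda>\<theta>. E t \<theta> * ((sin \<theta>)\<^sup>2 * F \<theta>)) - 4 * F 0 * (g 1 t / (2 * t * sqrt (t / 2)))\<bar> \<le>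
        4 * C * (M / ((2 * t)\<^sup>2 * sqrt (t / 2)))"
      by simp
    \<comment> \<open>Here \<open>gauss_moment 1\<close> is sqrt pi / 4, and the cut-off b = sqrt (2
      t) makes the relative error of order 1/t.\<close>
    have "\<bar>g 1 t - sqrt pi / 4\<bar> \<le> M / (2 * t)"
      using gauss_moment_tail[of "sqrt (2 * t)"] t by (simp add: g_def M_def gauss_moment_def)
    then have "4 * \<bar>F 0\<bar> * (\<bar>g 1 t - sqrt pi / 4\<bar> / (2 * t * sqrt (t / 2))) \<le> 4 * \<bar>F 0\<bar> * (M / (2 * t) / (2 * t * sqrt (t / 2)))"
      using t by (intro mult_left_mono divide_right_mono) auto
    also have "4 * \<bar>F 0\<bar> * (\<bar>g 1 t - sqrt pi / 4\<bar> / (2 * t * sqrt (t / 2))) =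
        \<bar>4 * F 0 * (g 1 t / (2 * t * sqrt (t / 2))) - 4 * F 0 * (sqrt pi / 4 / (2 * t * sqrt (t / 2)))\<bar>"
    proof -
      have "4 * F 0 * (g 1 t / (2 * t * sqrt (t / 2))) - 4 * F 0 * (sqrt pi / 4 / (2 * t * sqrt (t / 2))) =
          4 * F 0 * ((g 1 t - sqrt pi / 4) / (2 * t * sqrt (t / 2)))"
        by (simp only: diff_divide_distrib right_diff_distrib)
      then show ?thesis
        using t by (simp only: abs_mult abs_divide) simp
    qed
    finally have 2: "\<bar>4 * F 0 * (g 1 t / (2 * t * sqrt (t / 2))) - 4 * F 0 * (sqrt pi / 4 / (2 * t * sqrt (t / 2)))\<bar> \<le>
        4 * \<bar>F 0\<bar> * (M / (2 * t) / (2 * t * sqrt (t / 2)))" .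
    have p3: "t powr (3 / 2) = t * sqrt t"
      using t powr_add[of t 1 "1 / 2"] by (simp add: powr_half_sqrt)
    have "t powr (- 5 / 2) = 1 / (t powr (5 / 2))"
      using powr_minus_divide[of t "5 / 2"] by simp
    also have "t powr (5 / 2) = t\<^sup>2 * sqrt t"
      using t powr_add[of t 2 "1 / 2"] by (simp add: powr_half_sqrt)
    finally have p5: "t powr (- 5 / 2) = 1 / (t\<^sup>2 * sqrt t)" .
    have s2: "1 / sqrt (t / 2) = sqrt 2 / sqrt t"
      by (simp add: real_sqrt_divide)
    have "4 * F 0 * (sqrt pi / 4 / (2 * t * sqrt (t / 2))) = F 0 * sqrt pi * (1 / sqrt (t / 2)) / (2 * t)"
      by simp
    also have "\<dots> = F 0 * (sqrt pi * (sqrt 2 / 2)) / (t * sqrt t)"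
      unfolding s2 by (simp add: mult_ac)
    also have "sqrt 2 / 2 = 1 / sqrt 2"
      by (simp add: real_div_sqrt field_simps)
    finally have lead: "4 * F 0 * (sqrt pi / 4 / (2 * t * sqrt (t / 2))) = sqrt (pi / 2) * F 0 / t powr (3 / 2)"
      unfolding p3 by (simp add: real_sqrt_divide mult_ac)
    have err1: "4 * C * (M / ((2 * t)\<^sup>2 * sqrt (t / 2))) = sqrt 2 * M * C * t powr (- 5 / 2)"
    proof -
      have "4 * C * (M / ((2 * t)\<^sup>2 * sqrt (t / 2))) = C * M * (1 / sqrt (t / 2)) / t\<^sup>2"
        by (simp add: power_mult_distrib)
      then show ?thesis
        unfolding s2 p5 by (simp add: mult_ac)
    qed
    have err2: "4 * \<bar>F 0\<bar> * (M / (2 * t) / (2 * t * sqrt (t / 2))) = sqrt 2 * M * \<bar>F 0\<bar> * t powr (- 5 / 2)"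
    proof -
      have "4 * \<bar>F 0\<bar> * (M / (2 * t) / (2 * t * sqrt (t / 2))) = \<bar>F 0\<bar> * M * (1 / sqrt (t / 2)) / t\<^sup>2"
        by (simp add: power2_eq_square mult_ac)
      then show ?thesis
        unfolding s2 p5 by (simp add: mult_ac)
    qed
    have "\<bar>integral {0..pi} (\<lambda>\<theta>. E t \<theta> * ((sin \<theta>)\<^sup>2 * F \<theta>)) - sqrt (pi / 2) * F 0 / t powr (3 / 2)\<bar> \<le>
        sqrt 2 * M * C * t powr (- 5 / 2) + sqrt 2 * M * \<bar>F 0\<bar> * t powr (- 5 / 2)"
      using 1 2 unfolding lead err1 err2 by linarith
    then show ?thesis
      by (simp add: algebra_simps)
  qed
  show ?thesis
  proof (rule bigoI[where c = "sqrt 2 * M * (C + \<bar>F 0\<bar>)"])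
    show "\<forall>\<^sub>F t in at_top. norm (integral {0..pi} (\<lambda>\<theta>. exp (- t * (1 - cos \<theta>)) * ((sin \<theta>)\<^sup>2 * F \<theta>)) -
        sqrt (pi / 2) * F 0 / t powr (3 / 2)) \<le> sqrt 2 * M * (C + \<bar>F 0\<bar>) * norm (t powr (- 5 / 2))"
      using eventually_gt_at_top[of 0]
      by (rule eventually_mono) (use bound in \<open>simp add: E_def\<close>)
  qed
qed

text \<open>A global bound in place of a derivative condition: it passes to sums and products, and a
  uniform constant survives the limit of an infinite product.\<close>

definition quadratic_at_0 :: "(real \<Rightarrow> real) \<Rightarrow> bool" where
  "quadratic_at_0 f \<longleftrightarrow> (\<exists>C. \<forall>\<theta>\<in>{0..pi}. \<bar>f \<theta> - f 0\<bar> \<le> C * (sin (\<theta> / 2))\<^sup>2)"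

lemma quadratic_at_0_const: "quadratic_at_0 (\<lambda>_. c)"
  unfolding quadratic_at_0_def by (rule exI[of _ 0]) simp

lemma quadratic_at_0_add:
  assumes "quadratic_at_0 f" "quadratic_at_0 g"
  shows "quadratic_at_0 (\<lambda>\<theta>. f \<theta> + g \<theta>)"
proof -
  obtain C D where C: "\<And>\<theta>. \<theta> \<in> {0..pi} \<Longrightarrow> \<bar>f \<theta> - f 0\<bar> \<le> C * (sin (\<theta> / 2))\<^sup>2"
    and D: "\<And>\<theta>. \<theta> \<in> {0..pi} \<Longrightarrow> \<bar>g \<theta> - g 0\<bar> \<le> D * (sin (\<theta> / 2))\<^sup>2"
    using assms unfolding quadratic_at_0_def by blast
  have "\<bar>f \<theta> + g \<theta> - (f 0 + g 0)\<bar> \<le> (C + D) * (sin (\<theta> / 2))\<^sup>2" if "\<theta> \<in> {0..pi}" for \<theta>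
    using C[OF that] D[OF that] unfolding distrib_right by linarith
  then show ?thesis
    unfolding quadratic_at_0_def by blast
qed

lemma quadratic_at_0_mult:
  assumes "quadratic_at_0 f" "quadratic_at_0 g"
  shows "quadratic_at_0 (\<lambda>\<theta>. f \<theta> * g \<theta>)"
proof -
  obtain C D where C: "\<And>\<theta>. \<theta> \<in> {0..pi} \<Longrightarrow> \<bar>f \<theta> - f 0\<bar> \<le> C * (sin (\<theta> / 2))\<^sup>2"
    and D: "\<And>\<theta>. \<theta> \<in> {0..pi} \<Longrightarrow> \<bar>g \<theta> - g 0\<bar> \<le> D * (sin (\<theta> / 2))\<^sup>2"
    using assms unfolding quadratic_at_0_def by blast
  have "\<bar>f \<theta> * g \<theta> - f 0 * g 0\<bar> \<le> (C * (\<bar>g 0\<bar> + \<bar>D\<bar>) + \<bar>f 0\<bar> * D) * (sin (\<theta> / 2))\<^sup>2" if \<theta>: "\<theta> \<in> {0..pi}" for \<theta>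
  proof -
    let ?s = "(sin (\<theta> / 2))\<^sup>2"
    have s: "0 \<le> ?s" "?s \<le> 1"
      by (simp_all add: abs_square_le_1)
    have "D * ?s \<le> \<bar>D\<bar> * 1"
      using s by (intro mult_mono) auto
    with D[OF \<theta>] have g: "\<bar>g \<theta>\<bar> \<le> \<bar>g 0\<bar> + \<bar>D\<bar>"
      by linarith
    have "f \<theta> * g \<theta> - f 0 * g 0 = (f \<theta> - f 0) * g \<theta> + f 0 * (g \<theta> - g 0)"
      by (simp add: algebra_simps)
    also have "\<bar>\<dots>\<bar> \<le> \<bar>f \<theta> - f 0\<bar> * \<bar>g \<theta>\<bar> + \<bar>f 0\<bar> * \<bar>g \<theta> - g 0\<bar>"
      unfolding abs_mult[symmetric] by (rule abs_triangle_ineq)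
    also have "\<dots> \<le> C * ?s * (\<bar>g 0\<bar> + \<bar>D\<bar>) + \<bar>f 0\<bar> * (D * ?s)"
      using order_trans[OF abs_ge_zero C[OF \<theta>]] C[OF \<theta>] D[OF \<theta>] g
      by (intro add_mono mult_mono) auto
    finally show ?thesis
      by (simp add: algebra_simps)
  qed
  then show ?thesis
    unfolding quadratic_at_0_def by blast
qed

lemma quadratic_at_0_sum:
  assumes "finite A" "\<And>i. i \<in> A \<Longrightarrow> quadratic_at_0 (f i)"
  shows "quadratic_at_0 (\<lambda>\<theta>. \<Sum>i\<in>A. f i \<theta>)"
  using assms by (induction A rule: finite_induct) (simp_all add: quadratic_at_0_const quadratic_at_0_add)

lemma abs_sin_mult_le: "\<bar>sin (real m * x)\<bar> \<le> real m * \<bar>sin x\<bar>"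
proof (induction m)
  case (Suc m)
  have "sin (real (Suc m) * x) = sin (real m * x) * cos x + cos (real m * x) * sin x"
    by (simp add: distrib_right sin_add add.commute)
  also have "\<bar>\<dots>\<bar> \<le> \<bar>sin (real m * x)\<bar> * \<bar>cos x\<bar> + \<bar>cos (real m * x)\<bar> * \<bar>sin x\<bar>"
    unfolding abs_mult[symmetric] by (rule abs_triangle_ineq)
  also have "\<dots> \<le> real m * \<bar>sin x\<bar> * 1 + 1 * \<bar>sin x\<bar>"
    using Suc by (intro add_mono mult_mono) auto
  finally show ?case
    by (simp add: algebra_simps)
qed simp

text \<open>1 - cos (m \<theta>) = 2 sin^2 (m \<theta> / 2), and |sin (m x)| \<le> m |sin
  x|.\<close>

lemma quadratic_at_0_cos_int: "quadratic_at_0 (\<lambda>\<theta>. cos (real_of_int i * \<theta>))"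
proof -
  define m where "m = nat \<bar>i\<bar>"
  have "cos (real_of_int i * \<theta>) = cos (real m * \<theta>)" for \<theta>
    by (cases "i \<ge> 0") (simp_all add: m_def)
  moreover have "\<bar>cos (real m * \<theta>) - cos (real m * 0)\<bar> \<le> (2 * (real m)\<^sup>2) * (sin (\<theta> / 2))\<^sup>2" for \<theta>
  proof -
    have "\<bar>sin (real m * (\<theta> / 2))\<bar>\<^sup>2 \<le> (real m * \<bar>sin (\<theta> / 2)\<bar>)\<^sup>2"
      by (intro power_mono abs_sin_mult_le) auto
    moreover have "1 - cos (real m * \<theta>) = 2 * (sin (real m * (\<theta> / 2)))\<^sup>2"
      using one_minus_cos[of "real m * \<theta>"] by simp
    moreover have "cos (real m * \<theta>) \<le> 1"
      by simp
    ultimately show ?thesis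
      by (simp add: power_mult_distrib del: cos_le_one)
  qed
  ultimately show ?thesis
    unfolding quadratic_at_0_def by (metis mult_zero_right)
qed

lemma quadratic_at_0_cos_half: "quadratic_at_0 (\<lambda>\<theta>. cos (\<theta> / 2))"
  unfolding quadratic_at_0_def
proof (intro exI[of _ 1] ballI)
  fix \<theta> :: real
  assume "\<theta> \<in> {0..pi}"
  then have c: "0 \<le> cos (\<theta> / 2)" "cos (\<theta> / 2) \<le> 1"
    by (auto intro!: cos_ge_zero)
  then have "cos (\<theta> / 2) * cos (\<theta> / 2) \<le> cos (\<theta> / 2) * 1"
    by (intro mult_left_mono) auto
  moreover have "(sin (\<theta> / 2))\<^sup>2 = 1 - cos (\<theta> / 2) * cos (\<theta> / 2)"
    using sin_cos_squared_add[of "\<theta> / 2"] by (simp add: power2_eq_square)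
  ultimately show "\<bar>cos (\<theta> / 2) - cos (0 / 2)\<bar> \<le> 1 * (sin (\<theta> / 2))\<^sup>2"
    using c by simp
qed

text \<open>The difference is exactly 4 p (1 - c) times two quotients in [0, 1]. With p = q^(i+1)
  and c = cos (2 \<theta>) it compares one factor of the density at \<theta> and at 0, summably in
  i.\<close>

lemma density_factor_diff_le:
  fixes p c :: real
  assumes p: "0 < p" "p < 1" and c: "\<bar>c\<bar> \<le> 1"
  shows "\<bar>(1 - p)\<^sup>2 * (1 - 2 * p * c + p\<^sup>2) / ((1 + p)\<^sup>2 * (1 + 2 * p * c + p\<^sup>2)) -
      (1 - p)\<^sup>2 * (1 - p)\<^sup>2 / ((1 + p)\<^sup>2 * (1 + p)\<^sup>2)\<bar> \<le> 4 * p * (1 - c)"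
proof -
  define X where "X = 1 + 2 * p * c + p\<^sup>2"
  have "p * (- 1) \<le> p * c"
    using p c by (intro mult_left_mono) auto
  then have X: "(1 - p)\<^sup>2 \<le> X"
    by (simp add: X_def power2_eq_square algebra_simps)
  moreover have "0 < (1 - p)\<^sup>2"
    using p by simp
  ultimately have X0: "0 < X"
    by linarith
  have "(1 - p)\<^sup>2 * (1 - 2 * p * c + p\<^sup>2) / ((1 + p)\<^sup>2 * X) - (1 - p)\<^sup>2 * (1 - p)\<^sup>2 / ((1 + p)\<^sup>2 * (1 + p)\<^sup>2) =
      (1 - p)\<^sup>2 * ((1 - 2 * p * c + p\<^sup>2) * (1 + p)\<^sup>2 - (1 - p)\<^sup>2 * X) / ((1 + p)\<^sup>2 * X * (1 + p)\<^sup>2)"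
    using X0 p by (simp add: divide_simps) (simp add: algebra_simps)
  also have "(1 - 2 * p * c + p\<^sup>2) * (1 + p)\<^sup>2 - (1 - p)\<^sup>2 * X = 4 * p * (1 - c) * (1 + p\<^sup>2)"
    by (simp add: X_def power2_eq_square algebra_simps)
  also have "(1 - p)\<^sup>2 * (4 * p * (1 - c) * (1 + p\<^sup>2)) / ((1 + p)\<^sup>2 * X * (1 + p)\<^sup>2) =
      4 * p * (1 - c) * (((1 - p)\<^sup>2 / X) * ((1 + p\<^sup>2) / ((1 + p)\<^sup>2 * (1 + p)\<^sup>2)))"
    by (simp only: times_divide_times_eq times_divide_eq_right divide_divide_eq_left mult_ac)
  finally have eq: "(1 - p)\<^sup>2 * (1 - 2 * p * c + p\<^sup>2) / ((1 + p)\<^sup>2 * X) - (1 - p)\<^sup>2 * (1 - p)\<^sup>2 / ((1 + p)\<^sup>2 * (1 + p)\<^sup>2) =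
      4 * p * (1 - c) * (((1 - p)\<^sup>2 / X) * ((1 + p\<^sup>2) / ((1 + p)\<^sup>2 * (1 + p)\<^sup>2)))" .
  have "1 + p\<^sup>2 \<le> (1 + p)\<^sup>2"
    using p by (simp add: power2_eq_square algebra_simps)
  moreover have "1 \<le> (1 + p)\<^sup>2"
    using p by (intro one_le_power) auto
  ultimately have "(1 + p\<^sup>2) * 1 \<le> (1 + p)\<^sup>2 * (1 + p)\<^sup>2"
    by (intro mult_mono) auto
  then have B: "(1 + p\<^sup>2) / ((1 + p)\<^sup>2 * (1 + p)\<^sup>2) \<le> 1"
    using p by (simp add: divide_le_eq_1)
  have "4 * p * (1 - c) * (((1 - p)\<^sup>2 / X) * ((1 + p\<^sup>2) / ((1 + p)\<^sup>2 * (1 + p)\<^sup>2))) \<le> 4 * p * (1 - c) * (1 * 1)"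
    using X X0 B p c by (intro mult_left_mono mult_mono) (auto simp: divide_le_eq_1)
  moreover have "0 \<le> 4 * p * (1 - c) * (((1 - p)\<^sup>2 / X) * ((1 + p\<^sup>2) / ((1 + p)\<^sup>2 * (1 + p)\<^sup>2)))"
    using X0 p c by auto
  ultimately show ?thesis
    unfolding X_def[symmetric] eq by simp
qed

section \<open>The spectral density near 0\<close>

context nome
begin

lemma norm_jost_factor_sq:
  "(norm (jost_factor q i ((cis \<theta>)\<^sup>2)))\<^sup>2 =
    (1 - q ^ Suc i)\<^sup>2 * (1 - 2 * q ^ Suc i * cos (2 * \<theta>) + (q ^ Suc i)\<^sup>2) /
    ((1 + q ^ Suc i)\<^sup>2 * (1 + 2 * q ^ Suc i * cos (2 * \<theta>) + (q ^ Suc i)\<^sup>2))"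
proof -
  define p where "p = q ^ Suc i"
  have eq: "complex_of_real q ^ Suc i = of_real p"
    by (simp add: p_def)
  have z: "(cis \<theta>)\<^sup>2 = cis (2 * \<theta>)"
    unfolding Complex.DeMoivre by simp
  have n: "(norm (1 + of_real r * cis (2 * \<theta>)))\<^sup>2 = 1 + 2 * r * cos (2 * \<theta>) + r\<^sup>2" for r
  proof -
    have "(norm (1 + of_real r * cis (2 * \<theta>)))\<^sup>2 = (1 + r * cos (2 * \<theta>))\<^sup>2 + (r * sin (2 * \<theta>))\<^sup>2"
      unfolding cmod_power2 by simp
    also have "(1 + r * x)\<^sup>2 + (r * y)\<^sup>2 = 1 + 2 * r * x + r\<^sup>2 * (y\<^sup>2 + x\<^sup>2)" for x y
      by (simp add: power2_eq_square algebra_simps)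
    finally show ?thesis
      by (simp only: sin_cos_squared_add mult_1_right)
  qed
  have r: "(norm (1 + complex_of_real r))\<^sup>2 = (1 + r)\<^sup>2" for r
    unfolding cmod_power2 by simp
  show ?thesis
    unfolding jost_factor_def eq z norm_divide norm_mult power_divide power_mult_distrib p_def[symmetric]
    using n[of p] n[of "- p"] r[of p] r[of "- p"] by simp
qed

text \<open>All factors have modulus at most 1, so products differ by at most the sum of the
  differences of their factors, here a geometric series.\<close>

lemma quadratic_at_0_spectral_density: "quadratic_at_0 (spectral_density q)"
  unfolding quadratic_at_0_def
proof (intro exI ballI)
  fix \<theta> :: real
  assume "\<theta> \<in> {0..pi}"
  define a where "a i \<theta> = (norm (jost_factor q i ((cis \<theta>)\<^sup>2)))\<^sup>2" for i and \<theta> :: real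
  let ?s = "(sin (\<theta> / 2))\<^sup>2"
  have lim: "(\<lambda>N. \<Prod>i<N. a i \<theta>) \<longlonglongrightarrow> spectral_density q \<theta>" for \<theta>
  proof -
    have "(\<lambda>N. (norm (\<Prod>i<N. jost_factor q i ((cis \<theta>)\<^sup>2)))\<^sup>2) \<longlonglongrightarrow> spectral_density q \<theta>"
      unfolding spectral_density_def by (intro tendsto_intros jost_prod_LIMSEQ) (simp add: norm_power)
    then show ?thesis
      by (simp add: a_def prod_norm[symmetric] prod_power_distrib)
  qed
  have a1: "norm (a i \<theta>) \<le> 1" for i \<theta>
    using norm_jost_factor_le_1[of "(cis \<theta>)\<^sup>2" i] by (simp add: a_def norm_power power_le_one)
  \<comment> \<open>32 = 4 * 2 * 4: the constant of \<open>density_factor_diff_le\<close>, then 1 -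
    cos (2 \<theta>) = 2 sin^2 \<theta>, then sin^2 \<theta> \<le> 4 sin^2 (\<theta> / 2).\<close>
  have ad: "norm (a i \<theta> - a i 0) \<le> 32 * ?s * q ^ i" for i
  proof -
    define p where "p = q ^ Suc i"
    have p: "0 < p" "p < 1"
      using q_power_pos[of "Suc i"] q_power_Suc_less_1[of i] by (simp_all only: p_def)
    have "a i 0 = (1 - p)\<^sup>2 * (1 - p)\<^sup>2 / ((1 + p)\<^sup>2 * (1 + p)\<^sup>2)"
    proof -
      have "1 - 2 * p * cos (2 * 0) + p\<^sup>2 = (1 - p)\<^sup>2" "1 + 2 * p * cos (2 * 0) + p\<^sup>2 = (1 + p)\<^sup>2"
        by (simp_all add: power2_eq_square algebra_simps)
      then show ?thesis
        unfolding a_def norm_jost_factor_sq p_def[symmetric] by simp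
    qed
    then have "norm (a i \<theta> - a i 0) \<le> 4 * p * (1 - cos (2 * \<theta>))"
      unfolding real_norm_def a_def norm_jost_factor_sq p_def[symmetric]
      using density_factor_diff_le[OF p, of "cos (2 * \<theta>)"] by simp
    also have "1 - cos (2 * \<theta>) = 2 * (sin \<theta>)\<^sup>2"
      using one_minus_cos[of "2 * \<theta>"] by simp
    also have "(sin \<theta>)\<^sup>2 \<le> 4 * ?s"
    proof -
      have "sin \<theta> = 2 * sin (\<theta> / 2) * cos (\<theta> / 2)"
        using sin_double[of "\<theta> / 2"] by simp
      then have "(sin \<theta>)\<^sup>2 = 4 * ?s * (cos (\<theta> / 2))\<^sup>2"
        by (simp add: power_mult_distrib)
      also have "\<dots> \<le> 4 * ?s * 1"
        by (intro mult_left_mono) (auto simp: abs_square_le_1)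
      finally show ?thesis by simp
    qed
    finally have "norm (a i \<theta> - a i 0) \<le> 4 * p * (2 * (4 * ?s))"
      using p by simp
    also have "\<dots> \<le> 32 * ?s * q ^ i"
    proof -
      have "p \<le> q ^ i"
        unfolding p_def using q_pos q_less_1 by (intro power_decreasing) auto
      then have "32 * ?s * p \<le> 32 * ?s * q ^ i"
        by (intro mult_left_mono) auto
      then show ?thesis by (simp add: mult.commute)
    qed
    finally show ?thesis .
  qed
  have fin: "norm ((\<Prod>i<N. a i \<theta>) - (\<Prod>i<N. a i 0)) \<le> 32 / (1 - q) * ?s" for N
  proof -
    have "norm ((\<Prod>i<N. a i \<theta>) - (\<Prod>i<N. a i 0)) \<le> (\<Sum>i<N. norm (a i \<theta> - a i 0))"
      by (intro norm_prod_diff a1)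
    also have "\<dots> \<le> (\<Sum>i<N. 32 * ?s * q ^ i)"
      by (intro sum_mono ad)
    also have "\<dots> = 32 * ?s * (\<Sum>i<N. q ^ i)"
      by (simp only: sum_distrib_left)
    also have "\<dots> \<le> 32 * ?s * (\<Sum>i. q ^ i)"
      using q_pos q_less_1 by (intro mult_left_mono sum_le_suminf summable_geometric) auto
    also have "\<dots> = 32 / (1 - q) * ?s"
      using q_pos q_less_1 by (simp add: suminf_geometric)
    finally show ?thesis .
  qed
  have "(\<lambda>N. norm ((\<Prod>i<N. a i \<theta>) - (\<Prod>i<N. a i 0))) \<longlonglongrightarrow> norm (spectral_density q \<theta> - spectral_density q 0)"
    by (intro tendsto_intros lim)
  then have "norm (spectral_density q \<theta> - spectral_density q 0) \<le> 32 / (1 - q) * ?s"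
    by (rule LIMSEQ_le_const2) (use fin in auto)
  then show "\<bar>spectral_density q \<theta> - spectral_density q 0\<bar> \<le> 32 / (1 - q) * ?s"
    by simp
qed

lemma quadratic_at_0_Dpol: "quadratic_at_0 (Dpol q n)"
proof -
  have "quadratic_at_0 (\<lambda>\<theta>. cos ((2 * real k - real n + 1) * \<theta>))" for k
    using quadratic_at_0_cos_int[of "2 * int k - int n + 1"] by simp
  then show ?thesis
    unfolding Dpol_def by (intro quadratic_at_0_sum quadratic_at_0_mult quadratic_at_0_const) auto
qed

end

lemma qk_asymptotics:
  assumes \<kappa>: "\<kappa> > 0" and k: "k \<ge> 1"
  shows "(\<lambda>t. qk \<kappa> k n t - 1 / gam \<kappa> 1 * sqrt (2 / pi * (gam \<kappa> n / gam \<kappa> k))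
      * (qpoch_inf (qpar \<kappa>) (qpar \<kappa>)) ^ 4 / (qpoch_inf (- qpar \<kappa>) (qpar \<kappa>)) ^ 4
      * Ppol \<kappa> n 0 * Ppol \<kappa> k 0 / t powr (3 / 2)) \<in> O(\<lambda>t. t powr (- 5 / 2))"
proof -
  interpret nome "qpar \<kappa>"
    by (rule nome_qpar[OF \<kappa>])
  define F where "F \<theta> = Ppol \<kappa> n \<theta> * Ppol \<kappa> k \<theta> * spectral_density (qpar \<kappa>) \<theta>" for \<theta>
  define c where "c = 2 / (pi * gam \<kappa> 1) * sqrt (gam \<kappa> n / gam \<kappa> k)"
  have "quadratic_at_0 (\<lambda>\<theta>. cos (\<theta> / 2) * F \<theta>)"
    unfolding F_def Ppol_eq_Dpol
    by (intro quadratic_at_0_mult quadratic_at_0_const quadratic_at_0_Dpol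
        quadratic_at_0_spectral_density quadratic_at_0_cos_half)
  then have "\<exists>C. \<forall>\<theta>\<in>{0..pi}. \<bar>cos (\<theta> / 2) * F \<theta> - F 0\<bar> \<le> C * (sin (\<theta> / 2))\<^sup>2"
    unfolding quadratic_at_0_def by simp
  then obtain C where C: "\<And>\<theta>. \<theta> \<in> {0..pi} \<Longrightarrow> \<bar>cos (\<theta> / 2) * F \<theta> - F 0\<bar> \<le> C * (sin (\<theta> / 2))\<^sup>2"
    by blast
  have "continuous_on {0..pi} F"
    unfolding F_def Ppol_eq_Dpol by (intro continuous_intros)
  note asymp = laplace_asymptotics[OF this C]
  have "(\<lambda>t. c * (integral {0..pi} (\<lambda>\<theta>. exp (- t * (1 - cos \<theta>)) * ((sin \<theta>)\<^sup>2 * F \<theta>)) -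
      sqrt (pi / 2) * F 0 / t powr (3 / 2))) \<in> O(\<lambda>t. t powr (- 5 / 2))"
  \<comment> \<open>The case c = 0 covers \<open>n = 0\<close>, where \<open>gam\<close> vanishes
    and the claim is trivial.\<close>
  proof (cases "c = 0")
    case False
    then show ?thesis
      using asymp by (subst landau_o.big.cmult_in_iff)
  qed simp
  moreover have "c * (integral {0..pi} (\<lambda>\<theta>. exp (- t * (1 - cos \<theta>)) * ((sin \<theta>)\<^sup>2 * F \<theta>)) -
      sqrt (pi / 2) * F 0 / t powr (3 / 2)) =
      qk \<kappa> k n t - 1 / gam \<kappa> 1 * sqrt (2 / pi * (gam \<kappa> n / gam \<kappa> k))
      * (qpoch_inf (qpar \<kappa>) (qpar \<kappa>)) ^ 4 / (qpoch_inf (- qpar \<kappa>) (qpar \<kappa>)) ^ 4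
      * Ppol \<kappa> n 0 * Ppol \<kappa> k 0 / t powr (3 / 2)" for t
  proof -
    have "c * integral {0..pi} (\<lambda>\<theta>. exp (- t * (1 - cos \<theta>)) * ((sin \<theta>)\<^sup>2 * F \<theta>)) = qk \<kappa> k n t"
      unfolding qk_def spectral_density_eq_qpoch[symmetric] c_def F_def by (simp only: mult.assoc)
    moreover have "c * sqrt (pi / 2) = 1 / gam \<kappa> 1 * sqrt (2 / pi * (gam \<kappa> n / gam \<kappa> k))"
    proof -
      have "2 / pi * sqrt (pi / 2) = sqrt ((2 / pi)\<^sup>2) * sqrt (pi / 2)"
        by simp
      also have "\<dots> = sqrt (2 / pi)"
        unfolding real_sqrt_mult[symmetric] by (simp add: power2_eq_square)
      finally have "sqrt (2 / pi) = 2 / pi * sqrt (pi / 2)" ..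
      then show ?thesis
        unfolding c_def real_sqrt_mult by (simp add: mult_ac)
    qed
    moreover have "c * (sqrt (pi / 2) * F 0 / t powr (3 / 2)) = c * sqrt (pi / 2) * F 0 / t powr (3 / 2)"
      by (simp only: times_divide_eq_right mult.assoc)
    ultimately show ?thesis
      unfolding right_diff_distrib by (simp only: F_def spectral_density_0 times_divide_eq_right times_divide_eq_left mult_ac)
  qed
  ultimately show ?thesis
    by (simp only:)
qed

theorem theorem3p1:
  fixes \<kappa> :: real and q0 :: "nat \<Rightarrow> real"
  assumes kpos: "\<kappa> > 0"
    and q0bd: "\<forall>n\<ge>1. \<bar>q0 n\<bar> \<le> 1"
  shows
    "(\<forall>k\<ge>1. glauber_sol \<kappa> (\<lambda>n t. qk \<kappa> k n t) \<and>
        (\<forall>n\<ge>1. qk \<kappa> k n 0 = (if n = k then 1 else 0)) \<and>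
        (\<forall>x. glauber_sol \<kappa> x \<and> (\<forall>n\<ge>1. x n 0 = (if n = k then 1 else 0))
              \<longrightarrow> (\<forall>n. \<forall>t\<ge>0. x n t = qk \<kappa> k n t)))
     \<and>
     (\<forall>n t. t \<ge> 0 \<longrightarrow> summable (\<lambda>j. qk \<kappa> (j + 1) n t * q0 (j + 1)))
     \<and> glauber_sol \<kappa> (\<lambda>n t. \<Sum>j. qk \<kappa> (j + 1) n t * q0 (j + 1))
     \<and> (\<forall>n\<ge>1. (\<Sum>j. qk \<kappa> (j + 1) n 0 * q0 (j + 1)) = q0 n)
     \<and> (\<forall>x. glauber_sol \<kappa> x \<and> (\<forall>n\<ge>1. x n 0 = q0 n)
           \<longrightarrow> (\<forall>n. \<forall>t\<ge>0. x n t = (\<Sum>j. qk \<kappa> (j + 1) n t * q0 (j + 1))))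
     \<and>
     (\<forall>n\<ge>1. \<forall>k\<ge>1.
        (\<lambda>t. qk \<kappa> k n t
              - 1 / gam \<kappa> 1 * sqrt (2 / pi * (gam \<kappa> n / gam \<kappa> k))
                * (qpoch_inf (qpar \<kappa>) (qpar \<kappa>)) ^ 4 / (qpoch_inf (- qpar \<kappa>) (qpar \<kappa>)) ^ 4
                * Ppol \<kappa> n 0 * Ppol \<kappa> k 0 / t powr (3 / 2))
        \<in> O[at_top](\<lambda>t. t powr (- 5 / 2)))"
proof (intro conjI allI impI)
  have q0bd': "\<bar>q0 n\<bar> \<le> 1" if "n \<ge> 1" for n
    using q0bd that by blast
  \<comment> \<open>Identifies \<open>qk\<close> with the flow from a unit vector; existence,
    initial values, uniqueness and superposition then follow from the facts about flows.\<close>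
  have flow: "qk \<kappa> k = glauber_flow \<kappa> (\<lambda>n. if n = k then 1 else 0)" if "k \<ge> 1" for k
    using qk_eq_glauber_flow[OF kpos that] by (intro ext)
  have sums: "(\<lambda>j. qk \<kappa> (j + 1) n t * q0 (j + 1)) sums glauber_flow \<kappa> q0 n t" for n t
    using glauber_flow_unit_sums[OF kpos q0bd'] by (simp add: flow)
  have sum_eq: "(\<lambda>n t. \<Sum>j. qk \<kappa> (j + 1) n t * q0 (j + 1)) = glauber_flow \<kappa> q0"
    by (intro ext sums_unique[symmetric] sums)
  note sol = glauber_flow_solution[OF kpos q0bd']
  show sol_k: "glauber_sol \<kappa> (\<lambda>n t. qk \<kappa> k n t)" if "k \<ge> 1" for k
    unfolding flow[OF that] by (rule glauber_flow_solution[OF kpos]) simp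
  show init_k: "qk \<kappa> k n 0 = (if n = k then 1 else 0)" if "k \<ge> 1" "n \<ge> 1" for k n
    using that by (simp add: flow glauber_flow_initial)
  show "x n t = qk \<kappa> k n t"
    if "k \<ge> 1" "glauber_sol \<kappa> x \<and> (\<forall>n\<ge>1. x n 0 = (if n = k then 1 else 0))" "t \<ge> 0" for k x n t
  proof (rule glauber_sol_unique[OF kpos conjunct1[OF that(2)] sol_k[OF that(1)] _ that(3)])
    show "x m 0 = qk \<kappa> k m 0" if "m \<ge> 1" for m
      using conjunct2[OF \<open>glauber_sol \<kappa> x \<and> _\<close>] init_k[OF \<open>k \<ge> 1\<close> that] that by simp
  qed
  show "summable (\<lambda>j. qk \<kappa> (j + 1) n t * q0 (j + 1))" for n t
    by (rule sums_summable[OF sums])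
  show "glauber_sol \<kappa> (\<lambda>n t. \<Sum>j. qk \<kappa> (j + 1) n t * q0 (j + 1))"
    unfolding sum_eq by (rule sol)
  show init: "(\<Sum>j. qk \<kappa> (j + 1) n 0 * q0 (j + 1)) = q0 n" if "n \<ge> 1" for n
    using sums_unique[OF sums[of n 0]] glauber_flow_initial[OF that] by simp
  show "x n t = (\<Sum>j. qk \<kappa> (j + 1) n t * q0 (j + 1))"
    if "glauber_sol \<kappa> x \<and> (\<forall>n\<ge>1. x n 0 = q0 n)" "t \<ge> 0" for x n t
    unfolding sums_unique[OF sums, symmetric]
  proof (rule glauber_sol_unique[OF kpos conjunct1[OF that(1)] sol _ that(2)])
    show "x m 0 = glauber_flow \<kappa> q0 m 0" if "m \<ge> 1" for m
      using conjunct2[OF \<open>glauber_sol \<kappa> x \<and> _\<close>] glauber_flow_initial[OF that] that by simp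
  qed
  show "(\<lambda>t. qk \<kappa> k n t
              - 1 / gam \<kappa> 1 * sqrt (2 / pi * (gam \<kappa> n / gam \<kappa> k))
                * (qpoch_inf (qpar \<kappa>) (qpar \<kappa>)) ^ 4 / (qpoch_inf (- qpar \<kappa>) (qpar \<kappa>)) ^ 4
                * Ppol \<kappa> n 0 * Ppol \<kappa> k 0 / t powr (3 / 2))
        \<in> O[at_top](\<lambda>t. t powr (- 5 / 2))" if "k \<ge> 1" for n k
    by (rule qk_asymptotics[OF kpos that])
qed

end
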